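(* Let $F$ be the distribution function of a probability measure on $\mathbb{R}$ (the law of risk-neutral log-returns) with $\int_{\mathbb{R}} e^x\,dF(x)=1$. Let $M(s)=\int_{\mathbb{R}} e^{sx}\,dF(x)$, $-q^*=\inf\{s\in\mathbb{R}:M(s)<\infty\}$, $r^*=\sup\{s\in\mathbb{R}:M(s)<\infty\}$, let $V(k)$ denote the Black-Scholes implied volatility at log-strike $k$ associated with $F$, and let $\psi[x]=2-4\left(\sqrt{x^2+x}-x\right)$. (Left wing) If $q^*\in(0,\infty)$ and at least one of the following holds for some $\rho>0$ and some $l_1\in R_0$: - (I.i) for some integer $n\ge0$, $(-1)^nM^{(n)}(-q^*+s)\sim s^{-\rho}l_1(1/s)$ as $s\to0+$; - (II.i) $\log M(-q^*+s)\sim s^{-\rho}l_1(1/s)$ as $s\to0+$; then $$\frac{V(-k)^2}{k}\sim\psi(q^* )\quad\text{as }k\to\infty .$$ (Right wing) If $r^*=p^*+1\in(1,\infty)$ and at least one of the following holds for some $\rho>0$ and some $l_1\in R_0$: - (I.ii) for some integer $n\ge0$, $M^{(n)}(r^*-s)\sim s^{-\rho}l_1(1/s)$ as $s\to0+$; - (II.ii) $\log M(r^*-s)\sim s^{-\rho}l_1(1/s)$ as $s\to0+$; then $$\frac{V(k)^2}{k}\sim\psi(p^* )\quad\text{as }k\to\infty .$$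
   Context: The normalized Black-Scholes price of a call with log-strike $k$ is $c_{BS}(k,\sigma)=\Phi(d_1)-e^k\Phi(d_2)$ with $d_{1,2}(k)=-k/\sigma\pm\sigma/2$, where $\Phi$ is the standard normal distribution function. The implied volatility $V(k)$ is the unique value such that $c_{BS}(k,V(k))=\int_k^\infty(e^x-e^k)\,dF(x)$. $R_0$ denotes the class of functions slowly varying at infinity: positive measurable functions $l$, defined on a neighbourhood of $+\infty$, with $l(\lambda x)/l(x)\to1$ as $x\to\infty$ for every $\lambda>0$. $M^{(n)}$ is the $n$-th derivative of $M$ ($M^{(0)}=M$) on the open interval $(-q^*,r^* )$. $g\sim h$ means that the ratio $g/h$ tends to $1$ in the indicated limit. *)

theory Defs
  imports "HOL-Probability.Probability" "HOL-Library.Landau_Symbols"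
begin

(* The law of the log-returns is a measure \<mu> with real_distribution \<mu>; its distribution
   function is F = cdf \<mu>, and integrals dF(x) are integrals with respect to \<mu>. *)

definition mgf :: "real measure \<Rightarrow> real \<Rightarrow> ennreal" where
  "mgf \<mu> s = (\<integral>\<^sup>+ x. ennreal (exp (s * x)) \<partial>\<mu>)"

text \<open>The real-valued version agrees with \<^const>\<open>mgf\<close> wherever the latter is finite; its values
  elsewhere carry no meaning.\<close>

definition real_mgf :: "real measure \<Rightarrow> real \<Rightarrow> real" where
  "real_mgf \<mu> s = enn2real (mgf \<mu> s)"

definition q_star :: "real measure \<Rightarrow> ereal" where
  "q_star \<mu> = - (INF s \<in> {s. mgf \<mu> s < \<infinity>}. ereal s)"

definition r_star :: "real measure \<Rightarrow> ereal" where
  "r_star \<mu> = (SUP s \<in> {s. mgf \<mu> s < \<infinity>}. ereal s)"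

definition std_normal_cdf :: "real \<Rightarrow> real" where
  "std_normal_cdf = cdf std_normal_distribution"

definition bs_call :: "real \<Rightarrow> real \<Rightarrow> real" where
  "bs_call k \<sigma> =
     std_normal_cdf (- k / \<sigma> + \<sigma> / 2) - exp k * std_normal_cdf (- k / \<sigma> - \<sigma> / 2)"

definition call_price :: "real measure \<Rightarrow> real \<Rightarrow> real" where
  "call_price \<mu> k = (LINT x:{k..}|\<mu>. exp x - exp k)"

text \<open>When \<open>exp\<close> has integral 1 under the law, a positive solution exists, and is then unique, iff the
  law charges both sides of \<open>k\<close>. This holds for all large \<open>k\<close> if the right critical exponent is
  finite, and for all large \<open>-k\<close> if the left one is; for other \<open>k\<close> the value may be unspecified.\<close>

definition implied_vol :: "real measure \<Rightarrow> real \<Rightarrow> real" where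
  "implied_vol \<mu> k = (THE \<sigma>. 0 < \<sigma> \<and> bs_call k \<sigma> = call_price \<mu> k)"

text \<open>The functions here are total; only their restriction to some \<open>{a..}\<close> matters.\<close>

definition slowly_varying :: "(real \<Rightarrow> real) set" where
  "slowly_varying =
     {l. (\<exists>a. (\<forall>x\<ge>a. 0 < l x) \<and> l \<in> borel_measurable (lebesgue_on {a..})) \<and>
         (\<forall>c>0. ((\<lambda>x. l (c * x) / l x) \<longlongrightarrow> 1) at_top)}"

definition psi :: "real \<Rightarrow> real" where
  "psi x = 2 - 4 * (sqrt (x\<^sup>2 + x) - x)"

end

theory Submission
  imports Defs "HOL-Real_Asymp.Real_Asymp"
begin

text \<open>
  Chernoff's bound gives \<open>limsup ln (call_price k) / k \<le> - p\<close>. For the matching lower bound let \<open>\<nu>\<close>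
  be the law on \<open>[0, \<infinity>)\<close> reweighted by \<open>x ^ n * exp (r x)\<close>, with \<open>r = p + 1\<close> the critical exponent,
  and \<open>L\<close> its Laplace transform; it suffices that \<open>\<nu>\<close> eventually charges every window \<open>[k, b k]\<close>,
  \<open>b > 1\<close>, with mass at least 1. If \<open>L\<close> is regularly varying at 0, the laws proportional to
  \<open>exp (- x / k) \<nu>(dx)\<close>, rescaled by \<open>1 / k\<close>, converge to a Gamma law, which charges \<open>[1, b]\<close>. If
  \<open>ln L\<close> is regularly varying, the laws proportional to \<open>exp (- s x) \<nu>(dx)\<close> concentrate near
  \<open>\<rho> ln (L s) / s\<close>, and \<open>s\<close> can be chosen to put this point into the window.

  Since vega is the normal density at \<open>d\<^sub>1\<close>, the mean value theorem shows that the Black-Scholes price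
  at \<open>\<sigma> = sqrt (v k)\<close> decays exponentially at the rate \<open>1 / (2 v) - 1 / 2 + v / 8\<close>, which equals \<open>p\<close>
  at \<open>v = psi p\<close>. The left wing is the right wing of the law of the negated log-return under the
  share measure.
\<close>

subsection \<open>Black-Scholes prices along \<open>\<sigma> = sqrt (v k)\<close>\<close>

text \<open>Near \<open>x\<close> the distribution function is its value at \<open>x - 1\<close>
  plus the integral of the density from there, so the fundamental theorem of calculus applies. The
  base point \<open>x - 1\<close> keeps \<open>x\<close> in the interior of a compact
  interval.\<close>

lemma std_normal_cdf_has_field_derivative:
  "(std_normal_cdf has_field_derivative std_normal_density x) (at x)"
proof -
  interpret N: real_distribution std_normal_distribution by (rule real_dist_normal_dist)
  have cont: "continuous_on A std_normal_density" for A
    unfolding normal_density_def by (intro continuous_intros) auto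
  have eq: "std_normal_cdf y =
      std_normal_cdf (x - 1) + integral {x - 1..y} std_normal_density"
    if y: "y \<in> {x - 1..x + 1}" for y
  proof (cases "y = x - 1")
    case False
    then have lt: "x - 1 < y" using y by auto
    have "std_normal_cdf y - std_normal_cdf (x - 1)
        = measure std_normal_distribution {x - 1<..y}"
      unfolding std_normal_cdf_def by (rule N.cdf_diff_eq[OF lt])
    also have "\<dots> = (LINT t|std_normal_distribution. indicator {x - 1<..y} t)"
      by simp
    also have "\<dots> = (LINT t|lborel. std_normal_density t *\<^sub>R indicator {x - 1<..y} t)"
      by (subst integral_density) auto
    also have "\<dots> = (LINT t:{x - 1..y}|lborel. std_normal_density t)"
      unfolding set_lebesgue_integral_def
      by (intro integral_cong_AE) (use AE_lborel_singleton[of "x - 1"] in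
          \<open>auto simp: indicator_def mult.commute elim!: eventually_mono\<close>)
    also have "\<dots> = integral {x - 1..y} std_normal_density"
      by (rule set_borel_integral_eq_integral(2))
         (auto intro!: borel_integrable_atLeastAtMost' cont)
    finally show ?thesis by simp
  qed simp
  have "((\<lambda>y. integral {x - 1..y} std_normal_density) has_real_derivative std_normal_density x)
      (at x within {x - 1..x + 1})"
    by (rule integral_has_real_derivative) (auto intro: cont)
  then have "((\<lambda>y. integral {x - 1..y} std_normal_density) has_real_derivative std_normal_density x)
      (at x)"
    by (subst (asm) at_within_Icc_at) auto
  then have "((\<lambda>y. std_normal_cdf (x - 1) + integral {x - 1..y} std_normal_density)
      has_real_derivative std_normal_density x) (at x)"
    by (auto intro!: derivative_eq_intros)
  then show ?thesis
    by (rule has_field_derivative_transform_within[where d = 1, OF _ _ _ eq[symmetric]])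
       (auto simp: dist_real_def)
qed

lemma std_normal_cdf_at_top: "(std_normal_cdf \<longlongrightarrow> 1) at_top"
  and std_normal_cdf_at_bot: "(std_normal_cdf \<longlongrightarrow> 0) at_bot"
  unfolding std_normal_cdf_def
  using real_distribution.cdf_lim_at_top_prob[OF real_dist_normal_dist]
    finite_borel_measure.cdf_lim_at_bot[OF
      real_distribution.finite_borel_measure_M[OF real_dist_normal_dist]]
  by auto

lemma std_normal_cdf_minus: "std_normal_cdf (- x) = 1 - std_normal_cdf x"
proof -
  \<comment> \<open>The density is even, so \<open>h\<close> has derivative zero; its constant value
    is read off at infinity.\<close>
  define h where "h x = std_normal_cdf x + std_normal_cdf (- x)" for x
  have "(h has_field_derivative 0) (at x)" for x
    unfolding h_def
    by (auto intro!: derivative_eq_intros DERIV_chain2[OF std_normal_cdf_has_field_derivative]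
        simp: normal_density_def)
  then have const: "h x = h 0" for x
    by (metis DERIV_isconst_all)
  have "(h \<longlongrightarrow> 1 + 0) at_top"
    unfolding h_def
    by (intro tendsto_add std_normal_cdf_at_top
        filterlim_compose[OF std_normal_cdf_at_bot filterlim_uminus_at_bot_at_top])
  moreover have "(h \<longlongrightarrow> h 0) at_top"
    using const by (simp add: tendsto_eventually)
  ultimately have "h 0 = 1"
    by (metis add.right_neutral tendsto_unique trivial_limit_at_top_linorder)
  then show ?thesis
    using const[of x] by (simp add: h_def)
qed

text \<open>Put-call symmetry of the formula. Prices under a law and its dual obey the same
  relation, which is what carries implied volatilities from one wing to the other.\<close>

lemma bs_call_minus:
  "bs_call (- k) \<sigma> = 1 - exp (- k) + exp (- k) * bs_call k \<sigma>"
proof -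
  have e: "std_normal_cdf (k / \<sigma> + \<sigma> / 2) = 1 - std_normal_cdf (- k / \<sigma> - \<sigma> / 2)"
    "std_normal_cdf (k / \<sigma> - \<sigma> / 2) = 1 - std_normal_cdf (- k / \<sigma> + \<sigma> / 2)"
    using std_normal_cdf_minus[of "- k / \<sigma> - \<sigma> / 2"] std_normal_cdf_minus[of "- k / \<sigma> + \<sigma> / 2"]
    by (simp_all add: add.commute)
  have x: "exp (- k) * (exp k * y) = y" for y
    by (simp flip: mult.assoc exp_add)
  show ?thesis
    unfolding bs_call_def minus_minus e right_diff_distrib x by simp
qed

lemma bs_call_has_field_derivative:
  assumes "0 < \<sigma>"
  shows "(bs_call k has_field_derivative std_normal_density (- k / \<sigma> + \<sigma> / 2)) (at \<sigma>)"
proof -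
  \<comment> \<open>With this identity the terms in \<open>k / \<sigma>\<^sup>2\<close> cancel and
    the two halves add up to the density at d_1.\<close>
  have e: "exp k * std_normal_density (- k / \<sigma> - \<sigma> / 2) = std_normal_density (- k / \<sigma> + \<sigma> / 2)"
  proof -
    have "k + - (- k / \<sigma> - \<sigma> / 2)\<^sup>2 / 2 = - (- k / \<sigma> + \<sigma> / 2)\<^sup>2 / 2"
      using assms by (simp add: power2_eq_square field_simps)
    then show ?thesis
      by (simp add: normal_density_def flip: exp_add)
  qed
  have "(bs_call k has_field_derivative
      std_normal_density (- k / \<sigma> + \<sigma> / 2) * (k / \<sigma>\<^sup>2 + 1 / 2)
      - exp k * (std_normal_density (- k / \<sigma> - \<sigma> / 2) * (k / \<sigma>\<^sup>2 - 1 / 2))) (at \<sigma>)"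
    unfolding bs_call_def
    using assms
    by (auto intro!: derivative_eq_intros DERIV_chain2[OF std_normal_cdf_has_field_derivative]
        simp: power2_eq_square)
  also have "std_normal_density (- k / \<sigma> + \<sigma> / 2) * (k / \<sigma>\<^sup>2 + 1 / 2)
      - exp k * (std_normal_density (- k / \<sigma> - \<sigma> / 2) * (k / \<sigma>\<^sup>2 - 1 / 2))
      = std_normal_density (- k / \<sigma> + \<sigma> / 2)"
    unfolding mult.assoc[symmetric] e by (simp add: algebra_simps)
  finally show ?thesis .
qed

section \<open>Monotonicity, limits and solvability in the volatility\<close>

lemma bs_call_strict_mono:
  assumes "0 < \<sigma>" "\<sigma> < \<tau>"
  shows "bs_call k \<sigma> < bs_call k \<tau>"
proof (rule DERIV_pos_imp_increasing[OF assms(2)])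
  fix x assume "\<sigma> \<le> x" "x \<le> \<tau>"
  then have "0 < x" using assms by simp
  from bs_call_has_field_derivative[OF this]
  show "\<exists>y. (bs_call k has_real_derivative y) (at x) \<and> 0 < y"
    using normal_density_pos[of 1] by fastforce
qed

lemma bs_call_at_right_0:
  assumes "0 < k"
  shows "(bs_call k \<longlongrightarrow> 0) (at_right 0)"
proof -
  have 1: "filterlim (\<lambda>\<sigma>. - k / \<sigma> + \<sigma> / 2) at_bot (at_right 0)"
    using assms by real_asymp
  have 2: "filterlim (\<lambda>\<sigma>. - k / \<sigma> - \<sigma> / 2) at_bot (at_right 0)"
    using assms by real_asymp
  have "((\<lambda>\<sigma>. std_normal_cdf (- k / \<sigma> + \<sigma> / 2)
      - exp k * std_normal_cdf (- k / \<sigma> - \<sigma> / 2)) \<longlongrightarrow> 0 - exp k * 0) (at_right 0)"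
    by (intro tendsto_intros filterlim_compose[OF std_normal_cdf_at_bot 1]
        filterlim_compose[OF std_normal_cdf_at_bot 2])
  then show ?thesis by (simp add: bs_call_def[abs_def])
qed

lemma bs_call_at_top: "(bs_call k \<longlongrightarrow> 1) at_top"
proof -
  have 1: "filterlim (\<lambda>\<sigma>. - k / \<sigma> + \<sigma> / 2) at_top at_top"
    by real_asymp
  have 2: "filterlim (\<lambda>\<sigma>. - k / \<sigma> - \<sigma> / 2) at_bot at_top"
    by real_asymp
  have "((\<lambda>\<sigma>. std_normal_cdf (- k / \<sigma> + \<sigma> / 2)
      - exp k * std_normal_cdf (- k / \<sigma> - \<sigma> / 2)) \<longlongrightarrow> 1 - exp k * 0) at_top"
    by (intro tendsto_intros filterlim_compose[OF std_normal_cdf_at_top 1]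
        filterlim_compose[OF std_normal_cdf_at_bot 2])
  then show ?thesis by (simp add: bs_call_def[abs_def])
qed

lemma bs_call_solution_exists:
  assumes "0 < k" "0 < c" "c < 1"
  shows "\<exists>\<sigma>>0. bs_call k \<sigma> = c"
proof -
  have "\<forall>\<^sub>F \<sigma> in at_right 0. bs_call k \<sigma> < c \<and> 0 < \<sigma>"
    by (intro eventually_conj order_tendstoD(2)[OF bs_call_at_right_0] assms
        eventually_at_right_less)
  then obtain a where a: "bs_call k a < c" "0 < a"
    using eventually_happens[of _ "at_right (0::real)"] by auto
  have "\<forall>\<^sub>F \<sigma> in at_top. c < bs_call k \<sigma> \<and> a < \<sigma>"
    by (intro eventually_conj order_tendstoD(1)[OF bs_call_at_top] assms eventually_gt_at_top)
  then obtain b where b: "c < bs_call k b" "a < b"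
    using eventually_happens[of _ "at_top :: real filter"] by auto
  have "\<exists>x\<ge>a. x \<le> b \<and> bs_call k x = c"
    by (rule IVT) (use a b bs_call_has_field_derivative[THEN DERIV_isCont] in auto)
  then show ?thesis using a less_le_trans by blast
qed

text \<open>Along \<open>\<sigma> = sqrt (v * k)\<close> one has \<open>d\<^sub>1\<^sup>2 / 2 = k * bs_rate v\<close>; on \<open>(0, 2)\<close> the inverse of
  \<open>bs_rate\<close> is \<^const>\<open>psi\<close>.\<close>
definition bs_rate :: "real \<Rightarrow> real" where
  "bs_rate v = 1 / (2 * v) - 1 / 2 + v / 8"

text \<open>The difference of the rates is \<open>w - v\<close> times
  \<open>1 / (2 * v * w) - 1 / 8\<close>, which is positive as long as \<open>v * w < 4\<close>; the
  bound 2 on \<open>w\<close> ensures this.\<close>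

lemma bs_rate_strict_antimono:
  assumes "0 < v" "v < w" "w \<le> 2"
  shows "bs_rate w < bs_rate v"
proof -
  have "v * w < 4"
    using assms mult_less_le_imp_less[of v 2 w 2] by simp
  then have "0 < (w - v) * (1 / (2 * v * w) - 1 / 8)"
    using assms by (intro mult_pos_pos) (auto simp: field_simps)
  also have "\<dots> = bs_rate v - bs_rate w"
    using assms by (simp add: bs_rate_def field_simps)
  finally show ?thesis by simp
qed

text \<open>Cleared of denominators, \<open>bs_rate v = p\<close> is the quadratic equation
  \<open>v\<^sup>2 + 4 = (8 * p + 4) * v\<close>. Its roots have product 4, and \<open>psi p\<close>
  is the one below 2.\<close>

lemma psi_bounds:
  assumes "0 < p"
  shows "0 < psi p" "psi p < 2" "bs_rate (psi p) = p"
proof -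
  define r where "r = sqrt (p\<^sup>2 + p)"
  have r2: "r\<^sup>2 = p\<^sup>2 + p" using assms by (simp add: r_def)
  have "p < r"
    unfolding r_def using assms by (intro real_less_rsqrt) simp
  moreover have "r < p + 1 / 2"
    unfolding r_def using assms
    by (intro real_less_lsqrt) (auto simp: power2_eq_square algebra_simps)
  moreover have psi: "psi p = 2 - 4 * (r - p)" by (simp add: psi_def r_def)
  ultimately show "0 < psi p" "psi p < 2" by auto
  have "(psi p)\<^sup>2 + 4 = (8 * p + 4) * psi p"
    unfolding psi using r2 by (simp add: power2_eq_square algebra_simps)
  then show "bs_rate (psi p) = p"
    using \<open>0 < psi p\<close> by (simp add: bs_rate_def field_simps power2_eq_square)
qed

section \<open>Exponential bounds on the price\<close>

lemma std_normal_density_scaled: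
  assumes "0 < v" "0 < k"
  shows "std_normal_density (- k / sqrt (v * k) + sqrt (v * k) / 2)
    = exp (- k * bs_rate v) / sqrt (2 * pi)"
proof -
  have "(- k / sqrt (v * k) + sqrt (v * k) / 2)\<^sup>2 = 2 * k * bs_rate v"
    using assms unfolding power2_sum
    by (simp add: bs_rate_def power_divide power2_eq_square field_simps)
  then show ?thesis by (simp add: normal_density_def)
qed

text \<open>Vega increases with the volatility while d_1 stays nonpositive, that is, up to
  \<open>sqrt (2 * k)\<close>. Hence on an interval of such volatilities vega is extremal at the end
  points.\<close>

lemma std_normal_density_mono_neg:
  assumes "0 < \<sigma>" "\<sigma> \<le> \<tau>" "\<tau>\<^sup>2 \<le> 2 * k"
  shows "std_normal_density (- k / \<sigma> + \<sigma> / 2) \<le> std_normal_density (- k / \<tau> + \<tau> / 2)"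
proof -
  have "k \<ge> 0" using assms(3) by (smt (verit) zero_le_power2)
  then have "- k / \<sigma> \<le> - k / \<tau>"
    using assms by (simp add: frac_le)
  then have "- k / \<sigma> + \<sigma> / 2 \<le> - k / \<tau> + \<tau> / 2"
    using assms by auto
  moreover have "- k / \<tau> + \<tau> / 2 \<le> 0"
    using assms by (simp add: field_simps power2_eq_square)
  ultimately have "(- k / \<tau> + \<tau> / 2)\<^sup>2 \<le> (- k / \<sigma> + \<sigma> / 2)\<^sup>2"
    by (simp add: abs_le_square_iff[symmetric])
  then show ?thesis
    by (auto simp: normal_density_def intro!: divide_right_mono)
qed

text \<open>The price vanishes as the volatility tends to 0, so it is at most the final volatility
  times the final vega, the largest on the way.\<close>

lemma bs_call_upper:
  assumes "0 < v" "v < 2" "0 < k"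
  shows "bs_call k (sqrt (v * k)) \<le> sqrt (v * k) * exp (- k * bs_rate v)"
proof -
  define \<tau> where "\<tau> = sqrt (v * k)"
  have \<tau>: "0 < \<tau>" "\<tau>\<^sup>2 \<le> 2 * k" using assms by (auto simp: \<tau>_def)
  \<comment> \<open>The mean value theorem is applied from a positive volatility that then tends to
    0: the value \<open>bs_call k 0\<close> comes from division by zero and is not the limit of the
    prices.\<close>
  have bd: "bs_call k \<tau> \<le> bs_call k \<sigma> + \<tau> * exp (- k * bs_rate v)"
    if \<sigma>: "0 < \<sigma>" "\<sigma> < \<tau>" for \<sigma>
  proof -
    obtain z where z: "\<sigma> < z" "z < \<tau>"
      "bs_call k \<tau> - bs_call k \<sigma> = (\<tau> - \<sigma>) * std_normal_density (- k / z + z / 2)"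
      using MVT2[OF \<sigma>(2), of "bs_call k" "\<lambda>z. std_normal_density (- k / z + z / 2)"]
        bs_call_has_field_derivative \<sigma> by (metis less_le_trans)
    have "std_normal_density (- k / z + z / 2) \<le> std_normal_density (- k / \<tau> + \<tau> / 2)"
      by (rule std_normal_density_mono_neg) (use z \<sigma> \<tau> in auto)
    also have "\<dots> = exp (- k * bs_rate v) / sqrt (2 * pi)"
      unfolding \<tau>_def by (rule std_normal_density_scaled) (use assms in auto)
    also have "\<dots> \<le> exp (- k * bs_rate v) / 1"
      by (intro divide_left_mono) (use pi_gt3 in auto)
    finally have "(\<tau> - \<sigma>) * std_normal_density (- k / z + z / 2) \<le> \<tau> * exp (- k * bs_rate v)"
      using \<sigma> by (intro mult_mono) auto
    then show ?thesis using z by simp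
  qed
  have "((\<lambda>\<sigma>. bs_call k \<sigma> + \<tau> * exp (- k * bs_rate v)) \<longlongrightarrow> 0 + \<tau> * exp (- k * bs_rate v))
      (at_right 0)"
    by (intro tendsto_intros bs_call_at_right_0 assms)
  moreover have "\<forall>\<^sub>F \<sigma> in at_right 0. bs_call k \<tau> \<le> bs_call k \<sigma> + \<tau> * exp (- k * bs_rate v)"
    unfolding eventually_at_right_field using bd \<tau>(1) by blast
  ultimately have "bs_call k \<tau> \<le> 0 + \<tau> * exp (- k * bs_rate v)"
    using tendsto_lowerbound trivial_limit_at_right_real by blast
  then show ?thesis by (simp add: \<tau>_def)
qed

text \<open>Only the increase of the volatility from \<open>sqrt (w * k)\<close> to
  \<open>sqrt (v * k)\<close> is counted, with vega bounded below by its value at the bottom. This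
  gives the rate at \<open>w\<close> instead of \<open>v\<close>, a loss that is small when
  \<open>w\<close> is close to \<open>v\<close>.\<close>

lemma bs_call_lower:
  assumes "0 < w" "w < v" "v \<le> 2" "0 < k"
  shows "(sqrt (v * k) - sqrt (w * k)) * (exp (- k * bs_rate w) / sqrt (2 * pi))
    \<le> bs_call k (sqrt (v * k))"
proof -
  define \<sigma> where "\<sigma> = sqrt (w * k)"
  define \<tau> where "\<tau> = sqrt (v * k)"
  have st: "0 < \<sigma>" "\<sigma> < \<tau>" "\<tau>\<^sup>2 \<le> 2 * k" using assms by (auto simp: \<sigma>_def \<tau>_def)
  obtain z where z: "\<sigma> < z" "z < \<tau>"
      "bs_call k \<tau> - bs_call k \<sigma> = (\<tau> - \<sigma>) * std_normal_density (- k / z + z / 2)"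
    using MVT2[OF st(2), of "bs_call k" "\<lambda>z. std_normal_density (- k / z + z / 2)"]
      bs_call_has_field_derivative st by (metis less_le_trans)
  have "exp (- k * bs_rate w) / sqrt (2 * pi) = std_normal_density (- k / \<sigma> + \<sigma> / 2)"
    unfolding \<sigma>_def by (rule std_normal_density_scaled[symmetric]) (use assms in auto)
  also have "\<dots> \<le> std_normal_density (- k / z + z / 2)"
  proof (rule std_normal_density_mono_neg)
    have "z\<^sup>2 \<le> \<tau>\<^sup>2" using z st by (intro power_mono) auto
    then show "z\<^sup>2 \<le> 2 * k" using st by linarith
  qed (use z st in auto)
  finally have "(\<tau> - \<sigma>) * (exp (- k * bs_rate w) / sqrt (2 * pi)) \<le> bs_call k \<tau> - bs_call k \<sigma>"
    unfolding z(3) using st by (intro mult_left_mono) auto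
  moreover have "0 \<le> bs_call k \<sigma>"
  proof (rule tendsto_upperbound[OF bs_call_at_right_0[OF assms(4)]])
    show "\<forall>\<^sub>F x in at_right 0. bs_call k x \<le> bs_call k \<sigma>"
      unfolding eventually_at_right_field using bs_call_strict_mono st(1) less_imp_le by blast
  qed simp
  ultimately show ?thesis by (simp add: \<sigma>_def \<tau>_def)
qed

text \<open>The rate \<open>bs_rate\<close> decreases through \<open>p\<close> at
  \<open>psi p\<close>. So for \<open>v\<close> below \<open>psi p\<close> the price at
  \<open>sqrt (v * k)\<close> is exponentially smaller than \<open>c k\<close>, and for
  \<open>v\<close> above, up to 2, exponentially larger; strict monotonicity in the volatility then
  traps the solution.\<close>

lemma implied_vol_limit:
  assumes p: "0 < p"
    and c: "\<And>\<epsilon>. 0 < \<epsilon> \<Longrightarrow> \<forall>\<^sub>F k in at_top.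
      exp (- (p + \<epsilon>) * k) \<le> c k \<and> c k \<le> exp (- (p - \<epsilon>) * k)"
  shows "((\<lambda>k. (THE \<sigma>. 0 < \<sigma> \<and> bs_call k \<sigma> = c k)\<^sup>2 / k) \<longlongrightarrow> psi p) at_top"
proof -
  define V where "V k = (THE \<sigma>. 0 < \<sigma> \<and> bs_call k \<sigma> = c k)" for k
  note psi = psi_bounds[OF p]
  have c01: "\<forall>\<^sub>F k in at_top. 0 < c k \<and> c k < 1"
    using c[OF half_gt_zero[OF p]] eventually_gt_at_top[of 0]
  proof eventually_elim
    case (elim k)
    have "exp (- (p - p / 2) * k) < 1" using p elim by auto
    moreover have "0 < exp (- (p + p / 2) * k)" by simp
    ultimately show ?case using elim p by linarith
  qed
  have V: "\<forall>\<^sub>F k in at_top. 0 < k \<and> 0 < V k \<and> bs_call k (V k) = c k"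
    using c01 eventually_gt_at_top[of 0]
  proof eventually_elim
    case (elim k)
    obtain \<sigma> where \<sigma>: "0 < \<sigma>" "bs_call k \<sigma> = c k"
      using bs_call_solution_exists elim by blast
    have "\<exists>!\<sigma>. 0 < \<sigma> \<and> bs_call k \<sigma> = c k"
      by (rule ex1I[of _ \<sigma>]) (use \<sigma> bs_call_strict_mono in \<open>auto, metis less_irrefl linorder_neqE\<close>)
    from theI'[OF this] elim show ?case by (simp add: V_def)
  qed
  have lower: "\<forall>\<^sub>F k in at_top. v < (V k)\<^sup>2 / k" if v: "0 < v" "v < psi p" for v
  proof -
    \<comment> \<open>Half of the gap \<open>g - p\<close> is spent on the tolerance in the bounds
      for \<open>c k\<close>; the other half beats the prefactor
      \<open>sqrt (v * k)\<close>.\<close>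
    define g where "g = bs_rate v"
    define \<epsilon> where "\<epsilon> = (g - p) / 2"
    have "p < g" unfolding g_def
      using bs_rate_strict_antimono[OF v] psi by auto
    then have e: "0 < \<epsilon>" by (simp add: \<epsilon>_def)
    have "((\<lambda>k. sqrt (v * k) * exp (- \<epsilon> * k)) \<longlongrightarrow> 0) at_top"
      using e v by real_asymp
    then have "\<forall>\<^sub>F k in at_top. sqrt (v * k) * exp (- \<epsilon> * k) < 1"
      by (rule order_tendstoD) simp
    then show ?thesis
      using V c[OF e]
    proof eventually_elim
      case (elim k)
      have "bs_call k (sqrt (v * k)) \<le> sqrt (v * k) * exp (- k * g)"
        unfolding g_def by (rule bs_call_upper) (use v psi elim in auto)
      also have "exp (- k * g) = exp (- \<epsilon> * k) * exp (- (p + \<epsilon>) * k)"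
        by (simp add: \<epsilon>_def field_simps flip: exp_add)
      also have "sqrt (v * k) * \<dots> < 1 * exp (- (p + \<epsilon>) * k)"
        using mult_strict_right_mono[OF elim(1), of "exp (- (p + \<epsilon>) * k)"]
        by (simp add: mult.assoc)
      also have "\<dots> \<le> bs_call k (V k)" using elim by simp
      finally have "sqrt (v * k) < V k"
        using elim bs_call_strict_mono[of "V k" "sqrt (v * k)" k]
        by (metis less_irrefl less_trans linorder_neqE)
      then have "(sqrt (v * k))\<^sup>2 < (V k)\<^sup>2"
        using elim v by (intro power_strict_mono) auto
      then show ?case using elim v by (simp add: field_simps)
    qed
  qed
  have upper: "\<forall>\<^sub>F k in at_top. (V k)\<^sup>2 / k < v" if v: "psi p < v" "v < 2" for v
  proof -
    \<comment> \<open>The lower bound for the price at \<open>v\<close> has the rate of a smaller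
      \<open>w\<close>, so \<open>w\<close> is put between \<open>psi p\<close> and \<open>v\<close>
      to keep that rate below \<open>p\<close>.\<close>
    define w where "w = (psi p + v) / 2"
    have w: "0 < w" "psi p < w" "w < v" using v psi by (auto simp: w_def)
    define g where "g = bs_rate w"
    define \<epsilon> where "\<epsilon> = (p - g) / 2"
    have "g < p" unfolding g_def
      using bs_rate_strict_antimono[of "psi p" w] w psi v by auto
    then have e: "0 < \<epsilon>" by (simp add: \<epsilon>_def)
    have "sqrt w < sqrt v" using w by simp
    then have "filterlim (\<lambda>k. (sqrt v - sqrt w) * sqrt k * exp (\<epsilon> * k) / sqrt (2 * pi))
        at_top at_top"
      using e by real_asymp
    then have "\<forall>\<^sub>F k in at_top. 1 < (sqrt v - sqrt w) * sqrt k * exp (\<epsilon> * k) / sqrt (2 * pi)"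
      unfolding filterlim_at_top_dense by blast
    then show ?thesis
      using V c[OF e]
    proof eventually_elim
      case (elim k)
      have "bs_call k (V k) \<le> 1 * exp (- (p - \<epsilon>) * k)" using elim by simp
      also have "\<dots> < (sqrt v - sqrt w) * sqrt k * exp (\<epsilon> * k) / sqrt (2 * pi)
          * exp (- (p - \<epsilon>) * k)"
        using elim by (intro mult_strict_right_mono) auto
      also have "\<dots> = (sqrt v - sqrt w) * sqrt k * (exp (\<epsilon> * k)
          * exp (- (p - \<epsilon>) * k) / sqrt (2 * pi))" by simp
      also have "exp (\<epsilon> * k) * exp (- (p - \<epsilon>) * k) = exp (- k * g)"
        by (simp add: \<epsilon>_def field_simps flip: exp_add)
      also have "(sqrt v - sqrt w) * sqrt k = sqrt (v * k) - sqrt (w * k)"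
        by (simp add: real_sqrt_mult algebra_simps)
      also have "(sqrt (v * k) - sqrt (w * k)) * (exp (- k * g) / sqrt (2 * pi))
          \<le> bs_call k (sqrt (v * k))"
        unfolding g_def by (rule bs_call_lower) (use v w elim in auto)
      finally have "V k < sqrt (v * k)"
        using elim v psi bs_call_strict_mono[of "sqrt (v * k)" "V k" k]
        by (smt (verit) mult_pos_pos real_sqrt_gt_zero)
      then have "(V k)\<^sup>2 < (sqrt (v * k))\<^sup>2"
        using elim v by (intro power_strict_mono) auto
      then show ?case using elim v psi by (simp add: field_simps)
    qed
  qed
  have "((\<lambda>k. (V k)\<^sup>2 / k) \<longlongrightarrow> psi p) at_top"
  proof (rule order_tendstoI)
    fix a assume "a < psi p"
    \<comment> \<open>The bound \<open>lower\<close> speaks of positive numbers only, so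
      \<open>a\<close> is raised to a positive number still below \<open>psi p\<close>; the second
      half caps \<open>a\<close> below 2 in the same way.\<close>
    then have "\<forall>\<^sub>F k in at_top. max a (psi p / 2) < (V k)\<^sup>2 / k"
      using psi by (intro lower) auto
    then show "\<forall>\<^sub>F k in at_top. a < (V k)\<^sup>2 / k"
      by eventually_elim simp
  next
    fix a assume "psi p < a"
    then have "\<forall>\<^sub>F k in at_top. (V k)\<^sup>2 / k < min a ((psi p + 2) / 2)"
      using psi by (intro upper) (auto simp: min_less_iff_disj)
    then show "\<forall>\<^sub>F k in at_top. (V k)\<^sup>2 / k < a"
      by eventually_elim simp
  qed
  then show ?thesis by (simp add: V_def)
qed

subsection \<open>Derivatives of moment generating functions\<close>

text \<open>Controls the difference quotients of \<open>exp\<close> uniformly in small steps, which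
  supplies the dominating function for differentiation under the integral.\<close>

lemma abs_exp_minus_one_le: "\<bar>exp y - 1\<bar> \<le> \<bar>y\<bar> * exp \<bar>y\<bar>" for y :: real
proof (cases "0 \<le> y")
  case True
  have "1 - y \<le> exp (- y)" using exp_ge_add_one_self[of "- y"] by simp
  then have "exp y * (1 - exp (- y)) \<le> exp y * y" by (intro mult_left_mono) auto
  then show ?thesis using True by (simp add: right_diff_distrib mult.commute flip: exp_add)
next
  case False
  have "1 + y \<le> exp y" by (rule exp_ge_add_one_self)
  moreover have "exp y \<le> 1" using False by simp
  ultimately have "\<bar>exp y - 1\<bar> \<le> - y * 1" by linarith
  also have "\<dots> \<le> - y * exp (- y)" using False by (intro mult_left_mono) auto
  finally show ?thesis using False by simp
qed

text \<open>A factor \<open>exp (d * \<bar>x\<bar>)\<close>, the price of a factor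
  \<open>\<bar>x\<bar>\<close>, is absorbed by moving the exponent by \<open>d\<close> to both
  sides.\<close>

lemma exp_abs_le: "exp (s * x + d * \<bar>x\<bar>) \<le> exp ((s - d) * x) + exp ((s + d) * x)" for x :: real
  by (cases "0 \<le> x") (auto simp: algebra_simps)

text \<open>Each power of \<open>x\<close> is traded for a slightly wider exponential, as
  \<open>d * \<bar>x\<bar> \<le> exp (d * \<bar>x\<bar>)\<close>. A point strictly between
  \<open>a\<close> and \<open>b\<close> leaves room for any finite number of such trades, which is
  why the induction varies \<open>s\<close>.\<close>

lemma integrable_power_exp:
  fixes \<nu> :: "real measure"
  assumes [measurable_cong]: "sets \<nu> = sets borel"
    and a: "integrable \<nu> (\<lambda>x. exp (a * x))" and b: "integrable \<nu> (\<lambda>x. exp (b * x))"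
    and "a < s" "s < b"
  shows "integrable \<nu> (\<lambda>x. x ^ n * exp (s * x))"
  using assms(4,5)
proof (induction n arbitrary: s)
  case 0
  show ?case
  proof (rule Bochner_Integration.integrable_bound)
    show "integrable \<nu> (\<lambda>x. exp (a * x) + exp (b * x))" using a b by simp
    have "exp (s * x) \<le> exp (a * x) + exp (b * x)" for x
    proof (cases "0 \<le> x")
      case True
      then have "exp (s * x) \<le> exp (b * x)" using 0 by (simp add: mult_right_mono)
      then show ?thesis by (simp add: add.commute add_increasing)
    next
      case False
      then have "exp (s * x) \<le> exp (a * x)" using 0 by (simp add: mult_right_mono_neg)
      then show ?thesis by (simp add: add_increasing2)
    qed
    then show "AE x in \<nu>. norm (x ^ 0 * exp (s * x)) \<le> norm (exp (a * x) + exp (b * x))"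
      by (auto simp: abs_of_pos add_pos_pos)
  qed simp
next
  case (Suc n)
  define d where "d = min (s - a) (b - s) / 2"
  have d: "0 < d" "a < s - d" "s + d < b" using Suc.prems by (auto simp: d_def min_def field_simps)
  have i: "integrable \<nu> (\<lambda>x. x ^ n * exp ((s - d) * x))" "integrable \<nu> (\<lambda>x. x ^ n * exp ((s + d) * x))"
    using d by (auto intro!: Suc.IH)
  show ?case
  proof (rule Bochner_Integration.integrable_bound)
    show "integrable \<nu> (\<lambda>x. (\<bar>x ^ n * exp ((s - d) * x)\<bar> + \<bar>x ^ n * exp ((s + d) * x)\<bar>) / d)"
      using i by auto
    have "\<bar>x ^ Suc n * exp (s * x)\<bar>
        \<le> (\<bar>x ^ n * exp ((s - d) * x)\<bar> + \<bar>x ^ n * exp ((s + d) * x)\<bar>) / d" for x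
    proof -
      have "d * \<bar>x\<bar> \<le> exp (d * \<bar>x\<bar>)" using exp_ge_add_one_self[of "d * \<bar>x\<bar>"] by linarith
      then have "(d * \<bar>x\<bar>) * exp (s * x) \<le> exp (d * \<bar>x\<bar>) * exp (s * x)"
        by (rule mult_right_mono) simp
      also have "\<dots> = exp (s * x + d * \<bar>x\<bar>)" by (simp add: add.commute flip: exp_add)
      also note exp_abs_le
      finally have "\<bar>x\<bar> ^ n * ((d * \<bar>x\<bar>) * exp (s * x))
          \<le> \<bar>x\<bar> ^ n * (exp ((s - d) * x) + exp ((s + d) * x))"
        by (rule mult_left_mono) simp
      then show ?thesis using d by (simp add: abs_mult power_abs field_simps)
    qed
    then show "AE x in \<nu>. norm (x ^ Suc n * exp (s * x))
        \<le> norm ((\<bar>x ^ n * exp ((s - d) * x)\<bar> + \<bar>x ^ n * exp ((s + d) * x)\<bar>) / d)"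
      using d(1) by (auto simp: abs_of_nonneg)
  qed simp
qed

lemma integral_power_exp_has_derivative:
  fixes \<nu> :: "real measure"
  assumes [measurable_cong]: "sets \<nu> = sets borel"
    and a: "integrable \<nu> (\<lambda>x. exp (a * x))" and b: "integrable \<nu> (\<lambda>x. exp (b * x))"
    and s: "a < s" "s < b"
  shows "((\<lambda>s. LINT x|\<nu>. x ^ n * exp (s * x)) has_field_derivative
    (LINT x|\<nu>. x ^ Suc n * exp (s * x))) (at s)"
proof -
  note int = integrable_power_exp[OF assms(1-3)]
  define d where "d = min (s - a) (b - s) / 2"
  have d: "0 < d" "a < s - d" "s + d < b" using s by (auto simp: d_def min_def field_simps)
  let ?F = "\<lambda>s. LINT x|\<nu>. x ^ n * exp (s * x)"
  have "((\<lambda>h. (?F (s + h) - ?F s) / h) \<longlongrightarrow> (LINT x|\<nu>. x ^ Suc n * exp (s * x))) (at 0)"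
    unfolding tendsto_at_iff_sequentially comp_def
  proof (intro allI impI)
    fix h :: "nat \<Rightarrow> real" assume h0: "\<forall>i. h i \<in> UNIV - {0}" and h: "h \<longlonglongrightarrow> 0"
    have small: "\<forall>\<^sub>F i in sequentially. \<bar>h i\<bar> < d"
      using tendstoD[OF h d(1)] by (simp add: dist_real_def)
    let ?q = "\<lambda>i (x::real). x ^ n * exp (s * x) * ((exp (h i * x) - 1) / h i)"
    \<comment> \<open>The domination holds for steps below \<open>d\<close> only, whereas dominated
      convergence asks for it at every index; the finitely many other terms are replaced by
      0.\<close>
    have 1: "(\<lambda>i. LINT x|\<nu>. (if \<bar>h i\<bar> < d then ?q i x else 0))
        \<longlonglongrightarrow> (LINT x|\<nu>. x ^ Suc n * exp (s * x))"
    proof (rule integral_dominated_convergence)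
      show "integrable \<nu> (\<lambda>x. \<bar>x ^ Suc n * exp ((s - d) * x)\<bar> + \<bar>x ^ Suc n * exp ((s + d) * x)\<bar>)"
        using d by (intro Bochner_Integration.integrable_add integrable_abs int) auto
      show "AE x in \<nu>. (\<lambda>i. if \<bar>h i\<bar> < d then ?q i x else 0) \<longlonglongrightarrow> x ^ Suc n * exp (s * x)"
      proof (rule AE_I2)
        fix x :: real
        have "((\<lambda>y. exp (y * x)) has_field_derivative x) (at 0)"
          by (auto intro!: derivative_eq_intros)
        then have "((\<lambda>y. (exp (y * x) - 1) / y) \<longlongrightarrow> x) (at 0)"
          by (simp add: DERIV_def)
        then have "(\<lambda>i. (exp (h i * x) - 1) / h i) \<longlonglongrightarrow> x"
          unfolding tendsto_at_iff_sequentially comp_def using h0 h by blast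
        then have "(\<lambda>i. ?q i x) \<longlonglongrightarrow> x ^ n * exp (s * x) * x"
          by (intro tendsto_intros)
        then have "(\<lambda>i. ?q i x) \<longlonglongrightarrow> x ^ Suc n * exp (s * x)"
          by (simp add: mult_ac)
        then show "(\<lambda>i. if \<bar>h i\<bar> < d then ?q i x else 0) \<longlonglongrightarrow> x ^ Suc n * exp (s * x)"
          by (rule Lim_transform_eventually) (use small in \<open>auto elim!: eventually_mono\<close>)
      qed
      show "AE x in \<nu>. norm (if \<bar>h i\<bar> < d then ?q i x else 0)
          \<le> \<bar>x ^ Suc n * exp ((s - d) * x)\<bar> + \<bar>x ^ Suc n * exp ((s + d) * x)\<bar>" for i
      proof (intro AE_I2)
        fix x :: real
        have "\<bar>?q i x\<bar> \<le> \<bar>x ^ Suc n * exp ((s - d) * x)\<bar> + \<bar>x ^ Suc n * exp ((s + d) * x)\<bar>"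
          if hd: "\<bar>h i\<bar> < d"
        proof -
          have "\<bar>exp (h i * x) - 1\<bar> \<le> \<bar>h i * x\<bar> * exp \<bar>h i * x\<bar>"
            by (rule abs_exp_minus_one_le)
          also have "\<dots> \<le> \<bar>h i * x\<bar> * exp (d * \<bar>x\<bar>)"
            using hd by (intro mult_left_mono) (auto simp: abs_mult mult_right_mono)
          finally have "\<bar>(exp (h i * x) - 1) / h i\<bar> \<le> \<bar>x\<bar> * exp (d * \<bar>x\<bar>)"
            using h0 by (simp add: abs_mult field_simps)
          then have "exp (s * x) * \<bar>(exp (h i * x) - 1) / h i\<bar> \<le> exp (s * x) * (\<bar>x\<bar> * exp (d * \<bar>x\<bar>))"
            by (rule mult_left_mono) simp
          also have "\<dots> = \<bar>x\<bar> * exp (s * x + d * \<bar>x\<bar>)" by (simp add: exp_add)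
          also have "\<dots> \<le> \<bar>x\<bar> * (exp ((s - d) * x) + exp ((s + d) * x))"
            by (intro mult_left_mono exp_abs_le) simp
          finally have "\<bar>x\<bar> ^ n * (exp (s * x) * \<bar>(exp (h i * x) - 1) / h i\<bar>)
              \<le> \<bar>x\<bar> ^ n * (\<bar>x\<bar> * (exp ((s - d) * x) + exp ((s + d) * x)))"
            by (rule mult_left_mono) simp
          then show ?thesis by (simp add: abs_mult power_abs distrib_left mult_ac)
        qed
        then show "norm (if \<bar>h i\<bar> < d then ?q i x else 0)
          \<le> \<bar>x ^ Suc n * exp ((s - d) * x)\<bar> + \<bar>x ^ Suc n * exp ((s + d) * x)\<bar>"
          by auto
      qed
    qed auto
    have "\<forall>\<^sub>F i in sequentially. (LINT x|\<nu>. (if \<bar>h i\<bar> < d then ?q i x else 0))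
        = (?F (s + h i) - ?F s) / h i"
      using small
    proof eventually_elim
      case (elim i)
      have "(?F (s + h i) - ?F s) / h i
          = (LINT x|\<nu>. x ^ n * exp ((s + h i) * x) - x ^ n * exp (s * x)) / h i"
        using d s elim by (subst Bochner_Integration.integral_diff) (auto intro!: int)
      also have "\<dots> = (LINT x|\<nu>. (x ^ n * exp ((s + h i) * x) - x ^ n * exp (s * x)) / h i)"
        by simp
      also have "\<dots> = (LINT x|\<nu>. ?q i x)"
        by (intro Bochner_Integration.integral_cong) (simp_all add: algebra_simps exp_add)
      finally show ?case using elim by (simp only: if_True)
    qed
    from Lim_transform_eventually[OF 1 this]
    show "(\<lambda>i. (?F (s + h i) - ?F s) / h i) \<longlonglongrightarrow> (LINT x|\<nu>. x ^ Suc n * exp (s * x))" .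
  qed
  then show ?thesis by (simp add: DERIV_def)
qed

text \<open>This holds for every \<open>s\<close>: where the generating function is infinite, both
  sides take the default value 0.\<close>

lemma real_mgf_eq_integral:
  assumes [measurable_cong]: "sets \<mu> = sets borel"
  shows "real_mgf \<mu> s = (LINT x|\<mu>. exp (s * x))"
  by (simp add: real_mgf_def mgf_def integral_eq_nn_integral)

lemma higher_deriv_real_mgf:
  assumes \<mu>: "sets \<mu> = sets borel"
    and a: "integrable \<mu> (\<lambda>x. exp (a * x))" and b: "integrable \<mu> (\<lambda>x. exp (b * x))"
    and "a < s" "s < b"
  shows "(deriv ^^ n) (real_mgf \<mu>) s = (LINT x|\<mu>. x ^ n * exp (s * x))"
  using assms(4,5)
proof (induction n arbitrary: s)
  case 0
  then show ?case by (simp add: real_mgf_eq_integral[OF \<mu>])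
next
  case (Suc n)
  have "\<forall>\<^sub>F t in nhds s. t \<in> {a<..<b}"
    using Suc.prems by (intro eventually_nhds_in_open) auto
  \<comment> \<open>A derivative depends on the germ of the function at \<open>s\<close>, so the
    induction hypothesis is used on a whole neighbourhood.\<close>
  then have "\<forall>\<^sub>F t in nhds s. (deriv ^^ n) (real_mgf \<mu>) t = (LINT x|\<mu>. x ^ n * exp (t * x))"
    by eventually_elim (use Suc.IH in auto)
  then have "deriv ((deriv ^^ n) (real_mgf \<mu>)) s = deriv (\<lambda>t. LINT x|\<mu>. x ^ n * exp (t * x)) s"
    by (rule deriv_cong_ev) simp
  also have "\<dots> = (LINT x|\<mu>. x ^ Suc n * exp (s * x))"
    by (rule DERIV_imp_deriv[OF integral_power_exp_has_derivative[OF \<mu> a b Suc.prems]])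
  finally show ?case by simp
qed

lemma integrable_exp_iff_mgf:
  assumes [measurable_cong]: "sets \<mu> = sets borel"
  shows "integrable \<mu> (\<lambda>x. exp (s * x)) \<longleftrightarrow> mgf \<mu> s < \<infinity>"
  by (auto simp: mgf_def integrable_iff_bounded)

subsection \<open>Tauberian window estimates\<close>

text \<open>Euler's integral after the substitution of \<open>c * y\<close>; the factor
  \<open>c powr (1 - \<rho>)\<close> undoes the scaling of the power of \<open>y\<close>.\<close>

lemma gamma_moment:
  fixes \<rho> c :: real
  assumes "0 < \<rho>" "0 < c"
  shows "has_bochner_integral lborel (\<lambda>y. indicator {0<..} y * (y powr (\<rho> - 1) * exp (- (c * y))))
    (Gamma \<rho> * c powr - \<rho>)"
proof -
  let ?g = "\<lambda>y. indicator {0<..} y * (y powr (\<rho> - 1) * exp (- y)) :: real"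
  have "has_bochner_integral lborel ?g (Gamma \<rho>)"
  proof (rule has_bochner_integral_nn_integral)
    have "(\<integral>\<^sup>+y. ennreal (?g y) \<partial>lborel)
        = (\<integral>\<^sup>+y. ennreal (indicator {0..} y * y powr (\<rho> - 1) / exp y) \<partial>lborel)"
      by (intro nn_integral_cong) (auto simp: indicator_def exp_minus field_simps)
    then show "(\<integral>\<^sup>+y. ennreal (?g y) \<partial>lborel) = ennreal (Gamma \<rho>)"
      using Gamma_conv_nn_integral_real[OF assms(1)] by simp
  qed (use assms in \<open>auto simp: Gamma_real_nonneg\<close>)
  then have "has_bochner_integral lborel (\<lambda>y. ?g (0 + c * y)) (Gamma \<rho> /\<^sub>R \<bar>c\<bar>)"
    using assms by (subst (asm) lborel_has_bochner_integral_real_affine_iff[of c _ _ 0]) auto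
  then have "has_bochner_integral lborel (\<lambda>y. c powr (1 - \<rho>) * ?g (0 + c * y))
      (c powr (1 - \<rho>) * (Gamma \<rho> /\<^sub>R \<bar>c\<bar>))"
    by (rule has_bochner_integral_mult_right)
  also have "c powr (1 - \<rho>) * (Gamma \<rho> /\<^sub>R \<bar>c\<bar>) = Gamma \<rho> * c powr - \<rho>"
    using assms by (simp add: powr_diff powr_minus field_simps)
  also have "(\<lambda>y. c powr (1 - \<rho>) * ?g (0 + c * y))
      = (\<lambda>y. indicator {0<..} y * (y powr (\<rho> - 1) * exp (- (c * y))))"
  proof
    fix y
    have "c powr (1 - \<rho>) * c powr (\<rho> - 1) = 1"
      using assms by (simp flip: powr_add)
    then have "c powr (1 - \<rho>) * (c powr (\<rho> - 1) * z) = z" for z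
      by (simp flip: mult.assoc)
    then show "c powr (1 - \<rho>) * ?g (0 + c * y)
        = indicator {0<..} y * (y powr (\<rho> - 1) * exp (- (c * y)))"
      using assms by (auto simp: indicator_def powr_mult zero_less_mult_iff mult.assoc)
  qed
  finally show ?thesis .
qed

text \<open>A polynomial minorant of a window that keeps positive mass under the Gamma law: the numbers
  \<open>(1 + i) powr - \<rho>\<close> are the moments of \<open>exp (- Y)\<close> when \<open>Y\<close> has the Gamma law with shape \<open>\<rho>\<close>.\<close>
lemma polynomial_below_bump:
  fixes \<rho> a b :: real
  assumes \<rho>: "0 < \<rho>" and ab: "0 < a" "a < b"
  obtains p :: "nat \<Rightarrow> real" and n where
    "\<And>z. 0 \<le> z \<Longrightarrow> z \<le> 1 \<Longrightarrow> (\<Sum>i\<le>n. p i * z ^ i) \<le> indicator {exp (- b)..exp (- a)} z"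
    "0 < (\<Sum>i\<le>n. p i * (1 + real i) powr - \<rho>)"
proof -
  \<comment> \<open>A continuous bump, positive exactly between \<open>exp (- b)\<close> and
    \<open>exp (- a)\<close>, stands in for the indicator, which has no uniform polynomial
    approximation.\<close>
  define f where "f z = max 0 ((z - exp (- b)) * (exp (- a) - z))" for z :: real
  have f_nonneg: "0 \<le> f z" for z by (simp add: f_def)
  have f_le: "f z \<le> indicator {exp (- b)..exp (- a)} z" if "0 \<le> z" "z \<le> 1" for z
  proof (cases "z \<in> {exp (- b)..exp (- a)}")
    case True
    have "exp (- a) \<le> 1" using ab by simp
    then have "(z - exp (- b)) * (exp (- a) - z) \<le> 1 * 1"
      using True that by (intro mult_mono) (auto intro: order_trans[of _ "exp (- a)"] simp: diff_le_eq add_increasing2)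
    then show ?thesis using True by (simp add: f_def)
  next
    case False
    moreover have "exp (- b) < exp (- a)" using ab by simp
    ultimately have "(z - exp (- b)) * (exp (- a) - z) \<le> 0"
      unfolding mult_le_0_iff atLeastAtMost_iff by (smt (verit))
    then show ?thesis using False by (simp add: f_def)
  qed
  define g where "g y = indicator {0<..} y * (y powr (\<rho> - 1) * exp (- y))" for y :: real
  have g_int: "has_bochner_integral lborel (\<lambda>y. exp (- y) ^ i * g y)
      (Gamma \<rho> * (1 + real i) powr - \<rho>)" for i
  proof -
    have eq: "(\<lambda>y. exp (- y) ^ i * g y)
        = (\<lambda>y. indicator {0<..} y * (y powr (\<rho> - 1) * exp (- ((1 + real i) * y))))"
      by (auto simp: g_def algebra_simps simp flip: exp_of_nat_mult exp_add)
    show ?thesis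
      unfolding eq by (rule gamma_moment[OF \<rho>]) simp
  qed
  have g_meas[measurable]: "g \<in> borel_measurable borel" unfolding g_def by measurable
  have f_meas[measurable]: "f \<in> borel_measurable borel" unfolding f_def by measurable
  have g_nonneg: "0 \<le> g y" for y by (simp add: g_def)
  have g0: "integrable lborel g" "integral\<^sup>L lborel g = Gamma \<rho>"
    using g_int[of 0] by (auto simp: has_bochner_integral_iff)
  have fg: "integrable lborel (\<lambda>y. f (exp (- y)) * g y)"
  proof (rule Bochner_Integration.integrable_bound[OF g0(1)])
    have "f (exp (- y)) * g y \<le> 1 * g y" for y
    proof (cases "0 < y")
      case True
      then have "f (exp (- y)) \<le> 1"
        using f_le[of "exp (- y)"] by (intro order_trans[OF f_le]) (auto simp: indicator_def)
      then show ?thesis by (intro mult_right_mono g_nonneg)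
    qed (simp add: g_def)
    then show "AE y in lborel. norm (f (exp (- y)) * g y) \<le> norm (g y)"
      using f_nonneg g_nonneg by (auto simp: abs_mult)
  qed simp
  define I where "I = (LINT y|lborel. f (exp (- y)) * g y)"
  have "0 < I"
  proof (rule ccontr)
    assume "\<not> 0 < I"
    moreover have "0 \<le> I"
      unfolding I_def by (intro integral_nonneg_AE AE_I2 mult_nonneg_nonneg f_nonneg g_nonneg)
    ultimately have "I = 0" by simp
    then have "AE y in lborel. f (exp (- y)) * g y = 0"
      unfolding I_def using integral_nonneg_eq_0_iff_AE[OF fg] f_nonneg g_nonneg by auto
    then have "AE y in lborel. y \<notin> {a<..<b}"
      by eventually_elim (use ab in \<open>auto simp: f_def g_def\<close>)
    then have "emeasure lborel {a<..<b} = 0"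
      by (subst (asm) AE_iff_measurable[OF _ refl]) (auto simp: greaterThanLessThan_def greaterThan_def lessThan_def Collect_conj_eq)
    then show False using ab by simp
  qed
  have G: "0 < Gamma \<rho>" using \<rho> by (rule Gamma_real_pos)
  \<comment> \<open>An error of at most \<open>2 * e\<close> integrates to
    \<open>2 * e * Gamma \<rho> = I / 2\<close>, so half of the mass \<open>I\<close>
    survives.\<close>
  define e where "e = I / (4 * Gamma \<rho>)"
  have e: "0 < e" using \<open>0 < I\<close> G by (simp add: e_def)
  have "continuous_on {0..1} f" unfolding f_def by (intro continuous_intros)
  then obtain h where h: "real_polynomial_function h" "\<And>z. z \<in> {0..1} \<Longrightarrow> \<bar>f z - h z\<bar> < e"
    using Stone_Weierstrass_real_polynomial_function[of "{0..1::real}" f e] e by auto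
  \<comment> \<open>Lowering the approximation by \<open>e\<close> puts it below \<open>f\<close> on
    [0, 1], and no more than \<open>2 * e\<close> below.\<close>
  have "real_polynomial_function (\<lambda>z. h z - e)"
    using h(1) by (intro real_polynomial_function_diff) auto
  then obtain p n where p: "(\<lambda>z. h z - e) = (\<lambda>z. \<Sum>i\<le>n. p i * z ^ i)"
    unfolding real_polynomial_function_iff_sum by auto
  have lo: "f z - 2 * e \<le> (\<Sum>i\<le>n. p i * z ^ i)" and hi: "(\<Sum>i\<le>n. p i * z ^ i) \<le> f z"
    if "z \<in> {0..1}" for z
    using h(2)[OF that] fun_cong[OF p, of z] by (auto simp: abs_less_iff)
  have pint: "has_bochner_integral lborel (\<lambda>y. (\<Sum>i\<le>n. p i * exp (- y) ^ i) * g y)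
      (\<Sum>i\<le>n. p i * (Gamma \<rho> * (1 + real i) powr - \<rho>))"
    unfolding sum_distrib_right mult.assoc
    by (intro has_bochner_integral_sum has_bochner_integral_mult_right g_int)
  have "I - 2 * e * Gamma \<rho> = (LINT y|lborel. f (exp (- y)) * g y - 2 * e * g y)"
    unfolding I_def using fg g0 by (subst Bochner_Integration.integral_diff) auto
  also have "\<dots> \<le> (LINT y|lborel. (\<Sum>i\<le>n. p i * exp (- y) ^ i) * g y)"
  proof (rule integral_mono)
    show "integrable lborel (\<lambda>y. f (exp (- y)) * g y - 2 * e * g y)"
      using fg g0 by auto
    show "integrable lborel (\<lambda>y. (\<Sum>i\<le>n. p i * exp (- y) ^ i) * g y)"
      using pint by (simp add: has_bochner_integral_iff)
    fix y :: real
    show "f (exp (- y)) * g y - 2 * e * g y \<le> (\<Sum>i\<le>n. p i * exp (- y) ^ i) * g y"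
    proof (cases "0 < y")
      case True
      then have "(f (exp (- y)) - 2 * e) * g y \<le> (\<Sum>i\<le>n. p i * exp (- y) ^ i) * g y"
        by (intro mult_right_mono g_nonneg lo) auto
      then show ?thesis by (simp add: algebra_simps)
    qed (simp add: g_def)
  qed
  also have "\<dots> = Gamma \<rho> * (\<Sum>i\<le>n. p i * (1 + real i) powr - \<rho>)"
    using pint by (simp add: has_bochner_integral_iff sum_distrib_left mult_ac)
  finally have "0 < Gamma \<rho> * (\<Sum>i\<le>n. p i * (1 + real i) powr - \<rho>)"
    using \<open>0 < I\<close> G by (simp add: e_def)
  then have "0 < (\<Sum>i\<le>n. p i * (1 + real i) powr - \<rho>)"
    using G by (simp add: zero_less_mult_iff)
  then show thesis
    by (rule that[rotated]) (rule order_trans[OF hi f_le]; simp)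
qed

text \<open>On a bounded interval \<open>exp (- x)\<close> stays away from 0, so windows have finite
  mass under a possibly infinite measure, and \<open>measure\<close> does not fall back to its
  default 0 there.\<close>

lemma integrable_indicator_Icc:
  fixes \<nu> :: "real measure"
  assumes [measurable_cong]: "sets \<nu> = sets borel"
    and int: "integrable \<nu> (\<lambda>x. exp (- x))"
  shows "integrable \<nu> (indicator {a..b} :: real \<Rightarrow> real)"
proof (rule Bochner_Integration.integrable_bound)
  show "integrable \<nu> (\<lambda>x. exp b * exp (- x))" using int by simp
  show "AE x in \<nu>. norm (indicator {a..b} x :: real) \<le> norm (exp b * exp (- x))"
    by (auto simp: indicator_def simp flip: exp_add)
qed simp

text \<open>Integrability is asked for positive \<open>s\<close> only: the measure may be infinite,
  and it is infinite once \<open>L\<close> blows up at 0.\<close>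

locale laplace_measure =
  fixes \<nu> :: "real measure" and L :: "real \<Rightarrow> real"
  assumes sets_\<nu> [measurable_cong]: "sets \<nu> = sets borel"
    and nonneg: "AE x in \<nu>. 0 \<le> x"
    and int: "\<And>s. 0 < s \<Longrightarrow> integrable \<nu> (\<lambda>x. exp (- (s * x)))"
    and L_eq: "\<And>s. L s = (LINT x|\<nu>. exp (- (s * x)))"
begin

lemma int_indicator: "integrable \<nu> (indicator {a..b} :: real \<Rightarrow> real)"
  by (rule integrable_indicator_Icc[OF sets_\<nu>]) (use int[of 1] in simp)

lemma L_mono: "0 < s \<Longrightarrow> s \<le> t \<Longrightarrow> L t \<le> L s"
  unfolding L_eq
proof (rule integral_mono_AE)
  assume st: "0 < s" "s \<le> t"
  show "AE x in \<nu>. exp (- (t * x)) \<le> exp (- (s * x))"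
    using nonneg by eventually_elim (use st in \<open>simp add: mult_right_mono\<close>)
qed (auto intro!: int)

text \<open>Serves the intermediate value theorem that selects the tilt in
  \<open>window_log_regular\<close>.\<close>

lemma L_isCont:
  assumes "0 < s"
  shows "isCont L s"
proof -
  have "((\<lambda>t. LINT x|\<nu>. x ^ 0 * exp (t * x)) has_field_derivative
      (LINT x|\<nu>. x ^ Suc 0 * exp (- s * x))) (at (- s))"
    by (rule integral_power_exp_has_derivative[OF sets_\<nu>, of "- 2 * s" "- s / 2"])
       (use assms int[of "2 * s"] int[of "s / 2"] in auto)
  then have "isCont (\<lambda>t. LINT x|\<nu>. x ^ 0 * exp (t * x)) (- s)"
    by (rule DERIV_isCont)
  then have "isCont (\<lambda>t. LINT x|\<nu>. x ^ 0 * exp (- t * x)) s"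
    by (rule isCont_o2[rotated]) simp
  then show ?thesis by (simp add: L_eq[abs_def])
qed

end

section \<open>Mass of windows when the transform blows up at 0\<close>

locale laplace_blowup = laplace_measure +
  assumes L_at_top: "filterlim L at_top (at_right 0)"
begin

text \<open>Put \<open>s = 1 / k\<close> and \<open>z = exp (- (s * x))\<close>: the window becomes
  the interval from \<open>exp (- b)\<close> to \<open>exp (- 1)\<close>. A polynomial in
  \<open>z\<close> times \<open>z\<close> integrates to a combination of the
  \<open>L ((1 + i) * s)\<close>, which is asymptotically \<open>L s\<close> times the same
  combination of Gamma moments. For the polynomial minorant of the window this is positive, so the
  mass is at least a constant times \<open>L s\<close>, which exceeds 1 near 0.\<close>

lemma window_regular:
  assumes \<rho>: "0 < \<rho>"
    and rv: "\<And>c. 0 < c \<Longrightarrow> ((\<lambda>s. L (c * s) / L s) \<longlongrightarrow> c powr - \<rho>) (at_right 0)"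
    and b: "1 < b"
  shows "\<forall>\<^sub>F k in at_top. 1 \<le> measure \<nu> {k..b * k}"
proof -
  obtain p n where p: "\<And>z. 0 \<le> z \<Longrightarrow> z \<le> 1 \<Longrightarrow>
        (\<Sum>i\<le>n. p i * z ^ i) \<le> indicator {exp (- b)..exp (- 1 :: real)} z"
    and pos: "0 < (\<Sum>i\<le>n. p i * (1 + real i) powr - \<rho>)"
    using polynomial_below_bump[OF \<rho> _ b] by auto
  define E where "E = (\<Sum>i\<le>n. p i * (1 + real i) powr - \<rho>)"
  have "((\<lambda>s. \<Sum>i\<le>n. p i * (L ((1 + real i) * s) / L s)) \<longlongrightarrow> E) (at_right 0)"
    unfolding E_def by (intro tendsto_intros rv) simp
  then have "\<forall>\<^sub>F s in at_right 0. E / 2 < (\<Sum>i\<le>n. p i * (L ((1 + real i) * s) / L s))"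
    by (rule order_tendstoD) (use pos in \<open>simp add: E_def\<close>)
  moreover have "\<forall>\<^sub>F s in at_right 0. max 1 (2 / E) \<le> L s"
    using L_at_top unfolding filterlim_at_top by blast
  moreover have "\<forall>\<^sub>F s in at_right (0::real). 0 < s" by (rule eventually_at_right_less)
  ultimately have "\<forall>\<^sub>F s in at_right 0. 1 \<le> measure \<nu> {1 / s..b * (1 / s)}"
  proof eventually_elim
    case (elim s)
    have ip: "integrable \<nu> (\<lambda>x. p i * exp (- ((1 + real i) * s * x)))" for i
      by (intro integrable_mult_right int) (use elim in simp)
    have eq: "(\<Sum>i\<le>n. p i * exp (- ((1 + real i) * s * x)))
        = (\<Sum>i\<le>n. p i * exp (- (s * x)) ^ i) * exp (- (s * x))" for x
      unfolding sum_distrib_right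
      by (intro sum.cong refl) (simp add: algebra_simps flip: exp_of_nat_mult exp_add)
    have "1 \<le> E / 2 * (2 / E)" using pos by (simp add: E_def)
    also have "\<dots> \<le> E / 2 * L s" using elim pos by (intro mult_left_mono) (auto simp: E_def)
    also have "\<dots> \<le> (\<Sum>i\<le>n. p i * (L ((1 + real i) * s) / L s)) * L s"
      using elim by (intro mult_right_mono) auto
    also have "\<dots> = (\<Sum>i\<le>n. p i * L ((1 + real i) * s))"
      using elim by (simp add: sum_distrib_right)
    also have "\<dots> = (LINT x|\<nu>. (\<Sum>i\<le>n. p i * exp (- ((1 + real i) * s * x))))"
      using ip by (subst Bochner_Integration.integral_sum) (auto simp: L_eq)
    also have "\<dots> \<le> (LINT x|\<nu>. indicator {1 / s..b * (1 / s)} x)"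
    proof (rule integral_mono_AE)
      show "integrable \<nu> (\<lambda>x. \<Sum>i\<le>n. p i * exp (- ((1 + real i) * s * x)))"
        using ip by auto
      show "integrable \<nu> (\<lambda>x. indicator {1 / s..b * (1 / s)} x :: real)"
        by (rule int_indicator)
      show "AE x in \<nu>. (\<Sum>i\<le>n. p i * exp (- ((1 + real i) * s * x)))
          \<le> indicator {1 / s..b * (1 / s)} x"
        using nonneg
      proof eventually_elim
        case (elim x)
        have s: "0 < s" by fact
        have e1: "exp (- (s * x)) \<le> 1" using elim s by simp
        have "(\<Sum>i\<le>n. p i * exp (- (s * x)) ^ i) * exp (- (s * x))
            \<le> indicator {exp (- b)..exp (- 1)} (exp (- (s * x))) * exp (- (s * x))"
          by (intro mult_right_mono p e1) auto
        \<comment> \<open>The tilt that was carried along to reach the transform is at most 1 and is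
          dropped here, leaving the mass of the window itself.\<close>
        also have "\<dots> \<le> indicator {exp (- b)..exp (- 1)} (exp (- (s * x))) * 1"
          by (intro mult_left_mono e1) auto
        also have "\<dots> = indicator {1 / s..b * (1 / s)} x"
          using s by (auto simp: indicator_def field_simps)
        finally show ?case unfolding eq .
      qed
    qed
    finally show ?case by simp
  qed
  then show ?thesis
    unfolding eventually_at_right_to_top by (simp add: field_simps)
qed

text \<open>The tilted measure has mass \<open>L s\<close>, and Chernoff bounds leave at most half
  of it outside the window around \<open>m s\<close>. As the tilt is at most 1, the window has
  untilted mass at least \<open>L s / 2\<close>, hence at least 1.\<close>

lemma window_log_regular:
  assumes \<rho>: "0 < \<rho>"
    and rv: "\<And>c. 0 < c \<Longrightarrow> ((\<lambda>s. ln (L (c * s)) / ln (L s)) \<longlongrightarrow> c powr - \<rho>) (at_right 0)"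
    and b: "1 < b"
  shows "\<forall>\<^sub>F k in at_top. 1 \<le> measure \<nu> {k..b * k}"
proof -
  \<comment> \<open>If \<open>ln (L s)\<close> were a multiple of \<open>s powr - \<rho>\<close>,
    this would be minus its derivative, the mean of the tilted law.\<close>
  define m where "m s = \<rho> * ln (L s) / s" for s
  \<comment> \<open>Chosen so that \<open>(1 + \<eta>) / (1 - \<eta>) = b\<close>.\<close>
  define \<eta> where "\<eta> = (b - 1) / (b + 1)"
  have \<eta>: "0 < \<eta>" "\<eta> < 1" using b by (auto simp: \<eta>_def)
  have Lam: "filterlim (\<lambda>s. ln (L s)) at_top (at_right 0)"
    by (rule filterlim_compose[OF ln_at_top L_at_top])
  \<comment> \<open>Chernoff's bound with the tilt \<open>t\<close>: the exponent is \<open>ln (L s)\<close> times a function of \<open>t\<close>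
    with first-order term \<open>t * e * \<rho>\<close>, and is applied with \<open>t\<close> and \<open>e\<close> of opposite signs.\<close>
  have chernoff: "\<forall>\<^sub>F s in at_right 0. exp (t * s * (1 + e) * m s) * L ((1 + t) * s) \<le> L s / 4"
    if t: "- 1 < t" and neg: "(1 + t) powr - \<rho> - 1 + t * (1 + e) * \<rho> < 0" for t e
  proof -
    \<comment> \<open>One half of the gap covers the convergence of the ratio of logarithms; the
      other leaves a factor \<open>exp (- d * ln (L s))\<close>, which drops below 1/4.\<close>
    define d where "d = - ((1 + t) powr - \<rho> - 1 + t * (1 + e) * \<rho>) / 2"
    have d: "0 < d" using neg by (simp add: d_def)
    have "\<forall>\<^sub>F s in at_right 0. ln (L ((1 + t) * s)) / ln (L s) < (1 + t) powr - \<rho> + d"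
      by (rule order_tendstoD[OF rv]) (use t d in auto)
    moreover have "\<forall>\<^sub>F s in at_right 0. max 1 (ln 4 / d) \<le> ln (L s)"
      using Lam unfolding filterlim_at_top by blast
    moreover have "\<forall>\<^sub>F s in at_right 0. 2 \<le> L s"
      using L_at_top unfolding filterlim_at_top by blast
    moreover have "\<forall>\<^sub>F s in at_right 0. 2 \<le> L ((1 + t) * s)"
    proof -
      have "filterlim (\<lambda>s. (1 + t) * s) (at_right 0) (at_right 0)"
        by (rule filterlim_times_pos[of _ 0]) (use t in \<open>auto simp: filterlim_ident\<close>)
      from filterlim_compose[OF L_at_top this] show ?thesis
        unfolding filterlim_at_top by blast
    qed
    moreover have "\<forall>\<^sub>F s in at_right (0::real). 0 < s" by (rule eventually_at_right_less)
    ultimately show ?thesis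
    proof eventually_elim
      case (elim s)
      have "ln (L ((1 + t) * s)) < ((1 + t) powr - \<rho> + d) * ln (L s)"
        using elim by (simp add: divide_less_eq)
      then have "t * s * (1 + e) * m s + ln (L ((1 + t) * s))
          \<le> t * s * (1 + e) * m s + ((1 + t) powr - \<rho> + d) * ln (L s)" by simp
      also have "\<dots> = ln (L s) - d * ln (L s)"
        using elim by (simp add: m_def d_def field_simps)
      also have "\<dots> \<le> ln (L s) - ln 4"
        using elim d by (simp add: pos_divide_le_eq mult.commute)
      finally have "exp (t * s * (1 + e) * m s + ln (L ((1 + t) * s))) \<le> exp (ln (L s) - ln 4)"
        by simp
      then show ?case using elim by (simp add: exp_add exp_diff)
    qed
  qed
  have small: "\<exists>t. 0 < t \<and> t < 1 \<and> (1 + \<sigma> * t) powr - \<rho> - 1 + \<sigma> * t * (1 - \<sigma> * \<eta>) * \<rho> < 0"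
    if "\<sigma> = 1 \<or> \<sigma> = - 1" for \<sigma> :: real
  proof -
    \<comment> \<open>The sign \<open>\<sigma>\<close> treats both tails at once. The function
      vanishes at 0 with derivative \<open>- \<eta> * \<rho>\<close>, because
      \<open>\<sigma>\<close> squares to 1, so it is negative for small positive
      \<open>t\<close>.\<close>
    let ?h = "\<lambda>t. (1 + \<sigma> * t) powr - \<rho> - 1 + \<sigma> * t * (1 - \<sigma> * \<eta>) * \<rho>"
    have "(?h has_field_derivative - \<eta> * \<rho>) (at 0)"
      using that by (auto intro!: derivative_eq_intros simp: algebra_simps)
    then obtain d where d: "0 < d" "\<And>t. 0 < t \<Longrightarrow> t < d \<Longrightarrow> ?h t < ?h 0"
      using DERIV_neg_dec_right[of ?h "- \<eta> * \<rho>" 0] \<eta> \<rho> by auto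
    show ?thesis
      using d(2)[of "min d 1 / 2"] d(1) by (intro exI[of _ "min d 1 / 2"]) auto
  qed
  obtain t1 where t1: "0 < t1" "t1 < 1" "(1 + t1) powr - \<rho> - 1 + t1 * (1 - \<eta>) * \<rho> < 0"
    using small[of 1] by auto
  obtain t2 where t2: "0 < t2" "t2 < 1" "(1 - t2) powr - \<rho> - 1 - t2 * (1 + \<eta>) * \<rho> < 0"
    using small[of "- 1"] by auto
  have "\<forall>\<^sub>F s in at_right 0. exp (t1 * s * (1 - \<eta>) * m s) * L ((1 + t1) * s) \<le> L s / 4"
    using chernoff[of t1 "- \<eta>"] t1 by simp
  moreover have "\<forall>\<^sub>F s in at_right 0. exp (- t2 * s * (1 + \<eta>) * m s) * L ((1 - t2) * s) \<le> L s / 4"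
    using chernoff[of "- t2" \<eta>] t2 by simp
  moreover have "\<forall>\<^sub>F s in at_right 0. 2 \<le> L s"
    using L_at_top unfolding filterlim_at_top by blast
  moreover have "\<forall>\<^sub>F s in at_right (0::real). 0 < s" by (rule eventually_at_right_less)
  ultimately have "\<forall>\<^sub>F s in at_right 0. 0 < s \<and> 2 \<le> L s \<and> 1 \<le> measure \<nu> {(1 - \<eta>) * m s..(1 + \<eta>) * m s}"
  proof eventually_elim
    case (elim s)
    let ?A = "{(1 - \<eta>) * m s..(1 + \<eta>) * m s}"
    \<comment> \<open>The first summand dominates \<open>exp (- (s * x))\<close> to the left of the
      window, the second to the right; their integrals are the two Chernoff terms.\<close>
    let ?U = "\<lambda>x. exp (t1 * s * (1 - \<eta>) * m s) * exp (- ((1 + t1) * s * x))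
        + exp (- t2 * s * (1 + \<eta>) * m s) * exp (- ((1 - t2) * s * x))"
    have "0 \<le> m s" using elim \<rho> by (simp add: m_def)
    have i1: "integrable \<nu> (\<lambda>x. exp (- ((1 + t1) * s * x)))" and
        i2: "integrable \<nu> (\<lambda>x. exp (- ((1 - t2) * s * x)))"
      by (intro int; use elim t1 t2 in simp)+
    have "L s \<le> (LINT x|\<nu>. indicator ?A x + ?U x)"
      unfolding L_eq
    proof (rule integral_mono_AE)
      show "integrable \<nu> (\<lambda>x. exp (- (s * x)))" by (rule int) fact
      show "integrable \<nu> (\<lambda>x. indicator ?A x + ?U x)"
        using i1 i2 int_indicator by auto
      show "AE x in \<nu>. exp (- (s * x)) \<le> indicator ?A x + ?U x"
        using nonneg
      proof eventually_elim
        case (elim x)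
        have s: "0 < s" by fact
        consider "x \<in> ?A" | "x < (1 - \<eta>) * m s" | "(1 + \<eta>) * m s < x" by fastforce
        then show ?case
        proof cases
          case 1
          then have "exp (- (s * x)) \<le> indicator ?A x" using elim s by simp
          then show ?thesis by (simp add: add_increasing2)
        next
          case 2
          then have "t1 * s * x \<le> t1 * s * ((1 - \<eta>) * m s)"
            using s t1 by (intro mult_left_mono) auto
          then have "exp (- (s * x)) \<le> exp (t1 * s * (1 - \<eta>) * m s + - ((1 + t1) * s * x))"
            by (simp add: algebra_simps)
          also have "\<dots> \<le> ?U x" by (simp only: exp_add) simp
          also have "\<dots> \<le> indicator ?A x + ?U x" by simp
          finally show ?thesis .
        next
          case 3
          then have "t2 * s * ((1 + \<eta>) * m s) \<le> t2 * s * x"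
            using s t2 by (intro mult_left_mono) auto
          then have "exp (- (s * x)) \<le> exp (- t2 * s * (1 + \<eta>) * m s + - ((1 - t2) * s * x))"
            by (simp add: algebra_simps)
          also have "\<dots> \<le> ?U x" by (simp only: exp_add) simp
          also have "\<dots> \<le> indicator ?A x + ?U x" by simp
          finally show ?thesis .
        qed
      qed
    qed
    also have "\<dots> = measure \<nu> ?A + (exp (t1 * s * (1 - \<eta>) * m s) * L ((1 + t1) * s)
        + exp (- t2 * s * (1 + \<eta>) * m s) * L ((1 - t2) * s))"
      using i1 i2 int_indicator by (simp add: L_eq)
    also have "\<dots> \<le> measure \<nu> ?A + (L s / 4 + L s / 4)"
      using elim by (intro add_mono order_refl) auto
    finally show ?case using elim by auto
  qed
  then obtain s1 where s1: "0 < s1" "\<And>s. 0 < s \<Longrightarrow> s < s1 \<Longrightarrow>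
      2 \<le> L s \<and> 1 \<le> measure \<nu> {(1 - \<eta>) * m s..(1 + \<eta>) * m s}"
    unfolding eventually_at_right_field by blast
  define s2 where "s2 = s1 / 2"
  have s2: "0 < s2" "s2 < s1" using s1 by (auto simp: s2_def)
  have m_lim: "filterlim m at_top (at_right 0)"
  proof -
    have "filterlim (\<lambda>s. ln (L s) * (\<rho> * inverse s)) at_top (at_right 0)"
      using \<rho> by (intro filterlim_at_top_mult_at_top Lam
          filterlim_tendsto_pos_mult_at_top[OF tendsto_const] filterlim_inverse_at_top_right) auto
    then show ?thesis by (simp add: m_def[abs_def] field_simps)
  qed
  show ?thesis
    using eventually_ge_at_top[of "m s2"] eventually_gt_at_top[of 0]
  proof eventually_elim
    case (elim k)
    \<comment> \<open>The midpoint of the target window, whose ends are then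
      \<open>(1 - \<eta>) * K\<close> and \<open>(1 + \<eta>) * K\<close>. As \<open>m\<close> is
      continuous on the interval in question and unbounded near 0, some tilt below \<open>s1\<close>
      centres its window at \<open>K\<close>.\<close>
    define K where "K = k * ((b + 1) / 2)"
    have "k * 1 \<le> k * ((b + 1) / 2)" using elim b by (intro mult_left_mono) auto
    then have K: "m s2 \<le> K" using elim unfolding K_def by linarith
    have "\<forall>\<^sub>F s in at_right 0. K \<le> m s"
      using m_lim unfolding filterlim_at_top by blast
    with eventually_at_right_real[OF s2(1)]
    have "\<forall>\<^sub>F s in at_right 0. K \<le> m s \<and> 0 < s \<and> s < s2"
      by eventually_elim auto
    then obtain s3 where s3: "K \<le> m s3" "0 < s3" "s3 < s2"
      using eventually_happens[of _ "at_right (0::real)"] by auto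
    have "\<exists>s\<ge>s3. s \<le> s2 \<and> m s = K"
    proof (rule IVT2)
      show "\<forall>x. s3 \<le> x \<and> x \<le> s2 \<longrightarrow> isCont m x"
        unfolding m_def using s3 s1 s2
        by (auto intro!: continuous_intros L_isCont) (metis less_le_trans less_irrefl
            not_numeral_le_zero order_le_less_trans)
    qed (use s3 K in auto)
    then obtain s where "s3 \<le> s" "s \<le> s2" "m s = K" by blast
    then have s: "0 < s" "s < s1" "m s = K" using s3 s2 by linarith+
    have "(1 - \<eta>) * K = k" using b by (simp add: \<eta>_def K_def field_simps)
    moreover have "(1 + \<eta>) * K = b * k" using b by (simp add: \<eta>_def K_def field_simps)
    ultimately show ?case using s1(2)[OF s(1,2)] s(3) by simp
  qed
qed

end

subsection \<open>Call prices and the two wings\<close>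

text \<open>The quotient \<open>f (c * s) / f s\<close> is a product of two ratios to the model
  function, tending to 1, and the quotient of the model itself, where slow variation is used with
  the factor \<open>1 / c\<close> because the argument is \<open>1 / s\<close>.\<close>

lemma slowly_varying_imp_regular:
  fixes f :: "real \<Rightarrow> real"
  assumes l: "l \<in> slowly_varying"
    and f: "f \<sim>[at_right 0] (\<lambda>s. s powr - \<rho> * l (1 / s))"
  shows "\<forall>\<^sub>F s in at_right 0. 0 < f s"
    and "0 < c \<Longrightarrow> ((\<lambda>s. f (c * s) / f s) \<longlongrightarrow> c powr - \<rho>) (at_right 0)"
proof -
  define g where "g s = s powr - \<rho> * l (1 / s)" for s :: real
  have inv: "filterlim (\<lambda>s::real. 1 / s) at_top (at_right 0)"
    using filterlim_inverse_at_top_right by (simp add: inverse_eq_divide)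
  obtain a where "\<And>x. a \<le> x \<Longrightarrow> 0 < l x"
    using l by (auto simp: slowly_varying_def)
  then have "\<forall>\<^sub>F x in at_top. 0 < l x"
    unfolding eventually_at_top_linorder by blast
  then have "\<forall>\<^sub>F s in at_right 0. 0 < l (1 / s)"
    using inv by (rule eventually_compose_filterlim)
  with eventually_at_right_less[of 0] have g_pos: "\<forall>\<^sub>F s in at_right 0. 0 < g s \<and> 0 < s"
    by eventually_elim (auto simp: g_def)
  \<comment> \<open>Asymptotic equivalence counts 0/0 as 1; since \<open>g\<close> is eventually
    positive, it yields a genuine limit of the ratio.\<close>
  have fg: "((\<lambda>s. f s / g s) \<longlongrightarrow> 1) (at_right 0)"
    by (rule asymp_equivD_strong)
       (use f g_pos in \<open>auto simp: g_def[abs_def] elim!: eventually_mono\<close>)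
  then have "\<forall>\<^sub>F s in at_right 0. 0 < f s / g s"
    by (rule order_tendstoD) simp
  with g_pos show f_pos: "\<forall>\<^sub>F s in at_right 0. 0 < f s"
    by eventually_elim (auto simp: zero_less_divide_iff)
  assume c: "0 < c"
  have cs: "filterlim (\<lambda>s. c * s) (at_right 0) (at_right 0)"
    by (rule filterlim_times_pos[of _ 0]) (use c in \<open>auto simp: filterlim_ident\<close>)
  have "((\<lambda>x. l (1 / c * x) / l x) \<longlongrightarrow> 1) at_top"
    using l c unfolding slowly_varying_def mem_Collect_eq by (meson divide_pos_pos zero_less_one)
  then have "((\<lambda>s. l (1 / c * (1 / s)) / l (1 / s)) \<longlongrightarrow> 1) (at_right 0)"
    by (rule filterlim_compose[OF _ inv])
  then have "((\<lambda>s. (f (c * s) / g (c * s)) / (f s / g s) *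
      (c powr - \<rho> * (l (1 / c * (1 / s)) / l (1 / s)))) \<longlongrightarrow> 1 / 1 * (c powr - \<rho> * 1)) (at_right 0)"
    by (intro tendsto_intros fg filterlim_compose[OF fg cs]) auto
  moreover have "\<forall>\<^sub>F s in at_right 0. (f (c * s) / g (c * s)) / (f s / g s) *
      (c powr - \<rho> * (l (1 / c * (1 / s)) / l (1 / s))) = f (c * s) / f s"
    using g_pos eventually_compose_filterlim[OF g_pos cs] f_pos
  proof eventually_elim
    case (elim s)
    have *: "c powr - \<rho> * (l (1 / c * (1 / s)) / l (1 / s)) = g (c * s) / g s"
      using elim c by (simp add: g_def powr_mult)
    show ?case unfolding * using elim by simp
  qed
  ultimately show "((\<lambda>s. f (c * s) / f s) \<longlongrightarrow> c powr - \<rho>) (at_right 0)"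
    by (simp add: Lim_transform_eventually)
qed

text \<open>Along \<open>s / 2 ^ j\<close> the function grows geometrically, so no representation theorem for slowly
  varying functions is needed.\<close>
lemma regular_imp_unbounded:
  fixes f :: "real \<Rightarrow> real"
  assumes pos: "\<forall>\<^sub>F s in at_right 0. 0 < f s" and \<rho>: "0 < \<rho>"
    and rv: "((\<lambda>s. f (1 / 2 * s) / f s) \<longlongrightarrow> (1 / 2) powr - \<rho>) (at_right 0)"
    and d: "0 < d"
  obtains s where "0 < s" "s < d" "C < f s"
proof -
  have "(1::real) < 2 powr \<rho>" using \<rho> by simp
  also have "(2::real) powr \<rho> = (1 / 2) powr - \<rho>" by (simp add: powr_minus powr_divide)
  \<comment> \<open>Any \<open>q\<close> strictly between 1 and the limiting ratio is eventually a
    lower bound for the growth when \<open>s\<close> is halved.\<close>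
  finally obtain q :: real where q: "1 < q" "q < (1 / 2) powr - \<rho>" using dense by blast
  have "\<forall>\<^sub>F s in at_right 0. q < f (1 / 2 * s) / f s"
    by (rule order_tendstoD(1)[OF rv q(2)])
  with pos have "\<forall>\<^sub>F s in at_right 0. 0 < f s \<and> q * f s \<le> f (s / 2)"
    by eventually_elim (simp add: less_divide_eq)
  with eventually_at_right_real[OF d] have "\<forall>\<^sub>F s in at_right 0. s < d \<and> 0 < f s \<and> q * f s \<le> f (s / 2)"
    by eventually_elim auto
  then obtain e where e: "0 < e" "\<And>s. 0 < s \<Longrightarrow> s < e \<Longrightarrow> s < d \<and> 0 < f s \<and> q * f s \<le> f (s / 2)"
    unfolding eventually_at_right_field by blast
  have small: "0 < e / 2 / 2 ^ j" "e / 2 / 2 ^ j < e" for j :: nat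
  proof -
    have "(1::real) \<le> 2 ^ j" by simp
    then have "e / 2 / 2 ^ j \<le> e / 2" using e(1) by (simp add: divide_le_eq)
    then show "e / 2 / 2 ^ j < e" using e(1) by linarith
  qed (use e in simp)
  have grow: "q ^ j * f (e / 2) \<le> f (e / 2 / 2 ^ j)" for j
  proof (induction j)
    case (Suc j)
    have "q ^ Suc j * f (e / 2) \<le> q * f (e / 2 / 2 ^ j)"
      using Suc q by (simp add: mult.assoc)
    also have "\<dots> \<le> f (e / 2 / 2 ^ j / 2)" using e(2)[OF small] by blast
    finally show ?case by (simp add: mult.commute)
  qed simp
  obtain j where "C / f (e / 2) < q ^ j" using real_arch_pow[OF q(1)] by blast
  then have "C < q ^ j * f (e / 2)" using e(2)[of "e / 2"] e(1) by (simp add: divide_less_eq)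
  with grow[of j] small[of j] e(2)[OF small[of j]] that show thesis by force
qed

text \<open>For the lower bound the window starts at \<open>b * k\<close> instead of
  \<open>k\<close>, so that the payoff there is at least half of \<open>exp x\<close>; the remaining
  weight is at most its value at the far end \<open>b\<^sup>2 * k\<close>. The upper bound is
  Chernoff's, with an exponent just below \<open>p + 1\<close>.\<close>

lemma window_imp_call_price:
  assumes \<mu>: "real_distribution \<mu>" and p: "0 < p"
    and int: "\<And>t. 0 \<le> t \<Longrightarrow> t < p + 1 \<Longrightarrow> integrable \<mu> (\<lambda>x. exp (t * x))"
    and window: "\<And>b. 1 < b \<Longrightarrow> \<forall>\<^sub>F k in at_top. 1 \<le>
      (LINT x|\<mu>. indicator {0..} x * (x ^ n * exp ((p + 1) * x)) * indicator {k..b * k} x)"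
    and \<epsilon>: "0 < \<epsilon>"
  shows "\<forall>\<^sub>F k in at_top. exp (- (p + \<epsilon>) * k) \<le> call_price \<mu> k \<and>
    call_price \<mu> k \<le> exp (- (p - \<epsilon>) * k)"
proof -
  interpret real_distribution \<mu> by fact
  have int1: "integrable \<mu> (\<lambda>x. exp x)" using int[of 1] p by simp
  have ind: "integrable \<mu> (\<lambda>x. f x * indicator A x)" if "integrable \<mu> f" "A \<in> sets borel" for f :: "real \<Rightarrow> real" and A
    using integrable_mult_indicator[OF _ that(1), of A] that(2) by (simp add: mult.commute)
  have call: "call_price \<mu> k = (LINT x|\<mu>. (exp x - exp k) * indicator {k..} x)" for k
    unfolding call_price_def set_lebesgue_integral_def by (simp add: mult.commute)
  have icall: "integrable \<mu> (\<lambda>x. (exp x - exp k) * indicator {k..} x)" for k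
    by (rule ind) (use int1 in auto)
  \<comment> \<open>The far end of the window costs \<open>exp (p * b\<^sup>2 * k)\<close>; this
    choice makes it exceed \<open>exp (p * k)\<close> by \<open>exp (\<epsilon> / 2 * k)\<close>,
    leaving as much for the polynomial factor.\<close>
  define b where "b = sqrt (1 + \<epsilon> / (2 * p))"
  have b: "1 < b" "p * b\<^sup>2 = p + \<epsilon> / 2"
    using p \<epsilon> by (auto simp: b_def field_simps)
  have "filterlim (\<lambda>k. b * k) at_top at_top"
    by (rule filterlim_tendsto_pos_mult_at_top[OF tendsto_const _ filterlim_ident]) (use b in simp)
  then have "\<forall>\<^sub>F k in at_top. 1 \<le> (LINT x|\<mu>. indicator {0..} x * (x ^ n * exp ((p + 1) * x))
      * indicator {b * k..b * (b * k)} x)"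
    by (rule eventually_compose_filterlim[OF window[OF b(1)]])
  moreover have "\<forall>\<^sub>F k in at_top. exp (- (b - 1) * k) \<le> 1 / 2"
    using b by real_asymp
  moreover have "\<forall>\<^sub>F k in at_top. 2 * (b\<^sup>2 * k) ^ n \<le> exp (\<epsilon> / 2 * k)"
    using b \<epsilon> by real_asymp
  moreover have "\<forall>\<^sub>F k::real in at_top. 0 < k" by (rule eventually_gt_at_top)
  ultimately have lower: "\<forall>\<^sub>F k in at_top. exp (- (p + \<epsilon>) * k) \<le> call_price \<mu> k"
  proof eventually_elim
    case (elim k)
    let ?I = "{b * k..b * (b * k)}"
    let ?c = "(b\<^sup>2 * k) ^ n * exp (p * b\<^sup>2 * k)"
    note k = \<open>0 < k\<close>
    have "1 \<le> (LINT x|\<mu>. indicator {0..} x * (x ^ n * exp ((p + 1) * x)) * indicator ?I x)"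
      by (rule elim)
    also have "\<dots> \<le> (LINT x|\<mu>. ?c * (exp x * indicator ?I x))"
    proof (rule integral_mono_AE')
      show "integrable \<mu> (\<lambda>x. ?c * (exp x * indicator ?I x))"
        using ind[OF int1] by simp
      have "x ^ n * exp ((p + 1) * x) \<le> ?c * exp x" if x: "x \<in> ?I" for x
      proof -
        have "0 \<le> b * k" using b k by simp
        then have x0: "0 \<le> x" using x by auto
        have xb: "x \<le> b\<^sup>2 * k" using x by (simp add: power2_eq_square mult.assoc)
        have "x ^ n * (exp (p * x) * exp x) \<le> (b\<^sup>2 * k) ^ n * (exp (p * b\<^sup>2 * k) * exp x)"
          using x0 xb p by (intro mult_mono power_mono) (auto simp: mult.assoc)
        then show ?thesis by (simp add: distrib_right exp_add mult.assoc)
      qed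
      then show "AE x in \<mu>. indicator {0..} x * (x ^ n * exp ((p + 1) * x)) * indicator ?I x
          \<le> ?c * (exp x * indicator ?I x)"
        using k b by (auto simp: indicator_def)
      show "AE x in \<mu>. 0 \<le> ?c * (exp x * indicator ?I x)" using k by auto
    qed
    also have "\<dots> = ?c * (LINT x|\<mu>. exp x * indicator ?I x)" by simp
    also have "\<dots> \<le> ?c * (LINT x|\<mu>. 2 * ((exp x - exp k) * indicator {k..} x))"
    proof (intro mult_left_mono integral_mono)
      show "integrable \<mu> (\<lambda>x. exp x * indicator ?I x)" by (rule ind[OF int1]) simp
      show "integrable \<mu> (\<lambda>x. 2 * ((exp x - exp k) * indicator {k..} x))" using icall by simp
      show "0 \<le> ?c" using k by simp
      fix x
      show "exp x * indicator ?I x \<le> 2 * ((exp x - exp k) * indicator {k..} x)"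
      proof (cases "x \<in> ?I")
        case True
        then have "k - x \<le> - (b - 1) * k" by (simp add: algebra_simps)
        then have "exp (k - x) \<le> exp (- (b - 1) * k)" by (simp only: exp_le_cancel_iff)
        also have "\<dots> \<le> 1 / 2" by (rule elim)
        finally have "exp (k - x) \<le> 1 / 2" .
        then have "exp x * exp (k - x) \<le> exp x * (1 / 2)" by (intro mult_left_mono) auto
        then have "exp k \<le> exp x / 2" by (simp flip: exp_add)
        moreover have "k * 1 \<le> b * k" using b k by simp
        then have "k \<le> x" using True by auto
        ultimately show ?thesis by (auto simp: indicator_def)
      qed (auto simp: indicator_def)
    qed
    also have "\<dots> = (2 * (b\<^sup>2 * k) ^ n) * (exp (p * b\<^sup>2 * k) * call_price \<mu> k)" by (simp add: call)
    also have "\<dots> \<le> exp (\<epsilon> / 2 * k) * (exp (p * b\<^sup>2 * k) * call_price \<mu> k)"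
      by (intro mult_right_mono elim mult_nonneg_nonneg)
         (auto simp: call indicator_def intro!: integral_nonneg_AE)
    also have "\<dots> = exp ((p + \<epsilon>) * k) * call_price \<mu> k"
      unfolding b(2) by (simp add: algebra_simps flip: exp_add mult.assoc)
    finally have "exp (- (p + \<epsilon>) * k) * 1 \<le> exp (- (p + \<epsilon>) * k) * (exp ((p + \<epsilon>) * k) * call_price \<mu> k)"
      by (intro mult_left_mono) auto
    also have "\<dots> = call_price \<mu> k"
      by (simp add: algebra_simps flip: mult.assoc exp_add)
    finally show ?case by simp
  qed
  \<comment> \<open>The minimum with \<open>p / 2\<close> keeps \<open>t\<close> above 1.\<close>
  define t where "t = p + 1 - min (\<epsilon> / 2) (p / 2)"
  have t: "1 < t" "t < p + 1" "p - \<epsilon> / 2 \<le> t - 1" using p \<epsilon> by (auto simp: t_def min_def)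
  have it: "integrable \<mu> (\<lambda>x. exp (t * x))" by (rule int) (use t in auto)
  define M where "M = (LINT x|\<mu>. exp (t * x))"
  have "\<forall>\<^sub>F k in at_top. M \<le> exp (\<epsilon> / 2 * k)"
    using \<epsilon> by real_asymp
  moreover have "\<forall>\<^sub>F k::real in at_top. 0 < k" by (rule eventually_gt_at_top)
  ultimately have upper: "\<forall>\<^sub>F k in at_top. call_price \<mu> k \<le> exp (- (p - \<epsilon>) * k)"
  proof eventually_elim
    case (elim k)
    have "call_price \<mu> k \<le> (LINT x|\<mu>. exp (- (t - 1) * k) * exp (t * x))"
      unfolding call
    proof (rule integral_mono[OF icall])
      fix x
      show "(exp x - exp k) * indicator {k..} x \<le> exp (- (t - 1) * k) * exp (t * x)"
      proof (cases "k \<le> x")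
        case True
        have "(t - 1) * k \<le> (t - 1) * x" using t True by (intro mult_left_mono) auto
        then have "exp x \<le> exp (- (t - 1) * k + t * x)" by (simp add: algebra_simps)
        then have "exp x - exp k \<le> exp (- (t - 1) * k) * exp (t * x)"
          unfolding exp_add using exp_gt_zero[of k] by linarith
        then show ?thesis using True by simp
      qed simp
    qed (use it in simp)
    also have "\<dots> = exp (- (t - 1) * k) * M" by (simp add: M_def)
    also have "\<dots> \<le> exp (- (p - \<epsilon> / 2) * k) * exp (\<epsilon> / 2 * k)"
    proof (intro mult_mono elim)
      have "(p - \<epsilon> / 2) * k \<le> (t - 1) * k" using t elim by (intro mult_right_mono) auto
      then show "exp (- (t - 1) * k) \<le> exp (- (p - \<epsilon> / 2) * k)"
        by (simp only: exp_le_cancel_iff mult_minus_left neg_le_iff_le)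
    qed (auto simp: M_def intro!: integral_nonneg_AE)
    also have "\<dots> = exp (- (p - \<epsilon>) * k)" by (simp add: algebra_simps flip: exp_add)
    finally show ?case .
  qed
  from lower upper show ?thesis by eventually_elim auto
qed

text \<open>Discarding the negative half-line changes the integrals by a bounded amount, negligible
  against a transform that blows up. So the transform of the reweighted law inherits the assumed
  asymptotics, and the window lemmas apply.\<close>

lemma right_wing:
  assumes \<mu>: "real_distribution \<mu>" and p: "0 < p"
    and exp_int: "\<And>t. 0 \<le> t \<Longrightarrow> t < p + 1 \<Longrightarrow> integrable \<mu> (\<lambda>x. exp (t * x))"
    and \<rho>: "0 < \<rho>" and l: "l \<in> slowly_varying"
    and asymp: "(\<exists>n. (\<lambda>s. LINT x|\<mu>. x ^ n * exp ((p + 1 - s) * x))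
        \<sim>[at_right 0] (\<lambda>s. s powr - \<rho> * l (1 / s))) \<or>
      (\<lambda>s. ln (LINT x|\<mu>. exp ((p + 1 - s) * x)))
        \<sim>[at_right 0] (\<lambda>s. s powr - \<rho> * l (1 / s))"
  shows "(\<lambda>k. (implied_vol \<mu> k)\<^sup>2 / k) \<sim>[at_top] (\<lambda>k. psi p)"
proof -
  interpret real_distribution \<mu> by fact
  define h where "h n s = (LINT x|\<mu>. x ^ n * exp ((p + 1 - s) * x))" for n :: nat and s
  \<comment> \<open>In the logarithmic case \<open>n\<close> is 0, so a single weight serves both
    alternatives.\<close>
  obtain n where n: "h n \<sim>[at_right 0] (\<lambda>s. s powr - \<rho> * l (1 / s)) \<or>
      n = 0 \<and> (\<lambda>s. ln (h n s)) \<sim>[at_right 0] (\<lambda>s. s powr - \<rho> * l (1 / s))"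
    using asymp unfolding h_def[abs_def] by fastforce
  \<comment> \<open>The restriction to the half-line makes the weight nonnegative also for odd
    \<open>n\<close>, hence a density.\<close>
  define w where "w x = indicator {0..} x * (x ^ n * exp ((p + 1) * x))" for x :: real
  have w_nonneg: "0 \<le> w x" for x by (simp add: w_def indicator_def)
  have w_meas [measurable]: "w \<in> borel_measurable borel" unfolding w_def by measurable
  define \<nu> where "\<nu> = density \<mu> w"
  have h_int: "integrable \<mu> (\<lambda>x. x ^ n * exp (t * x))" if "0 < t" "t < p + 1" for t
  proof -
    note t = that
    obtain u where u: "t < u" "u < p + 1" using dense[OF t(2)] by blast
    show ?thesis
      by (rule integrable_power_exp[of _ 0 u]) (use exp_int u t in auto)
  qed
  define L where "L s = (LINT x|\<nu>. exp (- (s * x)))" for s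
  have w_exp: "w x * exp (- (s * x)) = indicator {0..} x * (x ^ n * exp ((p + 1 - s) * x))" for x s
    by (simp add: w_def left_diff_distrib exp_diff exp_minus field_simps)
  have L_w: "L s = (LINT x|\<mu>. indicator {0..} x * (x ^ n * exp ((p + 1 - s) * x)))" for s
    unfolding L_def \<nu>_def by (subst integral_density) (auto simp: w_nonneg w_exp)
  have w_int: "integrable \<mu> (\<lambda>x. w x * exp (- (s * x)))" if "0 < s" for s
  proof (cases "s < p + 1")
    case True
    have "integrable \<mu> (\<lambda>x. indicator {0..} x *\<^sub>R (x ^ n * exp ((p + 1 - s) * x)))"
      using True that by (intro integrable_mult_indicator h_int) auto
    then show ?thesis by (simp add: w_exp)
  next
    case False
    \<comment> \<open>The exponent \<open>p + 1 - s\<close> is now nonpositive and outside the range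
      of \<open>h_int\<close>; on the half-line the case \<open>s = 1\<close> dominates.\<close>
    have "integrable \<mu> (\<lambda>x. indicator {0..} x *\<^sub>R (x ^ n * exp ((p + 1 - 1) * x)))"
      using p by (intro integrable_mult_indicator h_int) auto
    then show ?thesis
    proof (rule Bochner_Integration.integrable_bound)
      have "x ^ n * exp ((p + 1 - s) * x) \<le> x ^ n * exp ((p + 1 - 1) * x)" if "0 \<le> x" for x
        using that False p by (intro mult_left_mono) (auto intro!: mult_right_mono)
      then show "AE x in \<mu>. norm (w x * exp (- (s * x)))
          \<le> norm (indicator {0..} x *\<^sub>R (x ^ n * exp ((p + 1 - 1) * x)))"
        unfolding w_exp by (auto simp: indicator_def abs_mult)
    qed simp
  qed
  interpret laplace_measure \<nu> L
  proof
    show "sets \<nu> = sets borel" by (simp add: \<nu>_def)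
    show "AE x in \<nu>. 0 \<le> x"
      unfolding \<nu>_def by (subst AE_density) (auto simp: w_def indicator_def)
    show "integrable \<nu> (\<lambda>x. exp (- (s * x)))" if "0 < s" for s
      unfolding \<nu>_def using w_int[OF that] by (subst integrable_density) (auto simp: w_nonneg)
  qed (rule L_def)
  \<comment> \<open>For \<open>s\<close> below \<open>(p + 1) / 2\<close> the exponent is at least
    \<open>(p + 1) / 2\<close>, so on the negative half-line this integrand dominates for all such
    \<open>s\<close> at once.\<close>
  define B where "B = (LINT x|\<mu>. \<bar>x ^ n * exp ((p + 1) / 2 * x)\<bar>)"
  have hL: "\<bar>h n s - L s\<bar> \<le> B" if s: "0 < s" "s < (p + 1) / 2" for s
  proof -
    have i1: "integrable \<mu> (\<lambda>x. x ^ n * exp ((p + 1 - s) * x))"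
      and i2: "integrable \<mu> (\<lambda>x. x ^ n * exp ((p + 1) / 2 * x))"
      by (rule h_int; use s p in simp)+
    have i3: "integrable \<mu> (\<lambda>x. indicator {0..} x * (x ^ n * exp ((p + 1 - s) * x)))"
      using w_int[OF s(1)] unfolding w_exp .
    have "\<bar>h n s - L s\<bar> = norm (LINT x|\<mu>. x ^ n * exp ((p + 1 - s) * x)
        - indicator {0..} x * (x ^ n * exp ((p + 1 - s) * x)))"
      unfolding h_def L_w using i1 i3 by (subst Bochner_Integration.integral_diff) auto
    also have "\<dots> \<le> B"
      unfolding B_def
    proof (rule Bochner_Integration.integral_norm_bound_integral)
      show "integrable \<mu> (\<lambda>x. \<bar>x ^ n * exp ((p + 1) / 2 * x)\<bar>)" using i2 by auto
      show "integrable \<mu> (\<lambda>x. x ^ n * exp ((p + 1 - s) * x)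
        - indicator {0..} x * (x ^ n * exp ((p + 1 - s) * x)))" using i1 i3 by simp
      fix x
      show "norm (x ^ n * exp ((p + 1 - s) * x)
          - indicator {0..} x * (x ^ n * exp ((p + 1 - s) * x))) \<le> \<bar>x ^ n * exp ((p + 1) / 2 * x)\<bar>"
      proof (cases "0 \<le> x")
        case False
        have "(p + 1 - s) * x \<le> (p + 1) / 2 * x"
          using False s by (intro mult_right_mono_neg) auto
        then have "\<bar>x ^ n\<bar> * exp ((p + 1 - s) * x) \<le> \<bar>x ^ n\<bar> * exp ((p + 1) / 2 * x)"
          by (intro mult_left_mono) auto
        then show ?thesis using False by (simp add: abs_mult)
      qed simp
    qed
    finally show ?thesis .
  qed
  have h0: "0 \<le> h 0 s" for s by (simp add: h_def)
  have h_unbdd: "\<exists>s. 0 < s \<and> s < d \<and> C < h n s" if d: "0 < d" for d C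
    using n
  proof (elim disjE conjE)
    assume *: "h n \<sim>[at_right 0] (\<lambda>s. s powr - \<rho> * l (1 / s))"
    show ?thesis
      by (rule regular_imp_unbounded[OF slowly_varying_imp_regular(1)[OF l *] \<rho>
            slowly_varying_imp_regular(2)[OF l *] d, of C]) auto
  next
    assume n0: "n = 0" and *: "(\<lambda>s. ln (h n s)) \<sim>[at_right 0] (\<lambda>s. s powr - \<rho> * l (1 / s))"
    obtain s where s: "0 < s" "s < d" "max 0 C < ln (h n s)"
      by (rule regular_imp_unbounded[OF slowly_varying_imp_regular(1)[OF l *] \<rho>
            slowly_varying_imp_regular(2)[OF l *] d, of "max 0 C"]) auto
    have "h n s \<noteq> 0" using s by auto
    then have "0 < h n s" using h0[of s] n0 by simp
    then have "ln (h n s) < h n s" using ln_less_self by blast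
    then show ?thesis using s by (intro exI[of _ s]) auto
  qed
  \<comment> \<open>One large value near 0 is enough, because \<open>L\<close> is
    decreasing.\<close>
  have L_lim: "filterlim L at_top (at_right 0)"
    unfolding filterlim_at_top
  proof
    fix C
    obtain s where s: "0 < s" "s < (p + 1) / 2" "C + B < h n s"
      using h_unbdd[of "(p + 1) / 2"] p by auto
    then have "C \<le> L s" using hL[of s] by linarith
    then have "C \<le> L t" if "0 < t" "t < s" for t
      using L_mono[of t s] that by linarith
    then show "\<forall>\<^sub>F t in at_right 0. C \<le> L t"
      unfolding eventually_at_right_field using s(1) by blast
  qed
  interpret laplace_blowup \<nu> L
    by unfold_locales (rule L_lim)
  have L_ge1: "\<forall>\<^sub>F s in at_right 0. 2 \<le> L s"
    using L_lim unfolding filterlim_at_top by blast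
  have ratio: "((\<lambda>s. h n s / L s) \<longlongrightarrow> 1) (at_right 0)"
  proof -
    have "((\<lambda>s. (h n s - L s) / L s) \<longlongrightarrow> 0) (at_right 0)"
    proof (rule Lim_null_comparison)
      show "((\<lambda>s. B / L s) \<longlongrightarrow> 0) (at_right 0)"
        by (rule real_tendsto_divide_at_top[OF tendsto_const L_lim])
      have "\<forall>\<^sub>F s in at_right 0. s \<in> {0<..<(p + 1) / 2}"
        by (rule eventually_at_right_real) (use p in simp)
      with L_ge1 show "\<forall>\<^sub>F s in at_right 0. norm ((h n s - L s) / L s) \<le> B / L s"
        by eventually_elim (use hL in \<open>auto intro!: divide_right_mono\<close>)
    qed
    then have "((\<lambda>s. (h n s - L s) / L s + 1) \<longlongrightarrow> 0 + 1) (at_right 0)"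
      by (intro tendsto_intros)
    then have "((\<lambda>s. (h n s - L s) / L s + 1) \<longlongrightarrow> 1) (at_right 0)" by simp
    then show ?thesis
      by (rule Lim_transform_eventually)
         (use L_ge1 in \<open>auto elim!: eventually_mono simp: field_simps\<close>)
  qed
  have window: "\<forall>\<^sub>F k in at_top. 1 \<le> measure \<nu> {k..b * k}" if b: "1 < b" for b
    using n
  proof (elim disjE conjE)
    assume *: "h n \<sim>[at_right 0] (\<lambda>s. s powr - \<rho> * l (1 / s))"
    have "L \<sim>[at_right 0] (\<lambda>s. s powr - \<rho> * l (1 / s))"
      using asymp_equiv_trans[OF asymp_equiv_symI[OF asymp_equivI'[OF ratio]] *] by simp
    from window_regular[OF \<rho> slowly_varying_imp_regular(2)[OF l this] b]
    show ?thesis by simp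
  next
    assume n0: "n = 0" and *: "(\<lambda>s. ln (h n s)) \<sim>[at_right 0] (\<lambda>s. s powr - \<rho> * l (1 / s))"
    \<comment> \<open>The logarithm of a ratio tending to 1 vanishes against
      \<open>ln (L s)\<close>, so the two logarithms are asymptotically equivalent.\<close>
    have "((\<lambda>s. ln (h n s / L s)) \<longlongrightarrow> ln 1) (at_right 0)"
      by (intro tendsto_ln ratio) simp
    then have "((\<lambda>s. ln (h n s / L s) / ln (L s) + 1) \<longlongrightarrow> 0 + 1) (at_right 0)"
      by (intro tendsto_add tendsto_const real_tendsto_divide_at_top
          filterlim_compose[OF ln_at_top L_lim])
    then have "((\<lambda>s. ln (h n s / L s) / ln (L s) + 1) \<longlongrightarrow> 1) (at_right 0)" by simp
    moreover have "\<forall>\<^sub>F s in at_right 0. 0 < h n s / L s"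
      by (rule order_tendstoD[OF ratio]) simp
    with L_ge1 have "\<forall>\<^sub>F s in at_right 0. ln (h n s / L s) / ln (L s) + 1 = ln (h n s) / ln (L s)"
    proof eventually_elim
      case (elim s)
      then have "0 < h n s" "0 < ln (L s)" by (auto simp: zero_less_divide_iff)
      then show ?case using elim by (simp add: ln_div field_simps)
    qed
    ultimately have "((\<lambda>s. ln (h n s) / ln (L s)) \<longlongrightarrow> 1) (at_right 0)"
      by (rule Lim_transform_eventually)
    from asymp_equiv_trans[OF asymp_equiv_symI[OF asymp_equivI'[OF this]] *]
    have "(\<lambda>s. ln (L s)) \<sim>[at_right 0] (\<lambda>s. s powr - \<rho> * l (1 / s))" .
    from window_log_regular[OF \<rho> slowly_varying_imp_regular(2)[OF l this] b]
    show ?thesis by simp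
  qed
  have "measure \<nu> {k..c} = (LINT x|\<mu>. w x * indicator {k..c} x)" for k c
  proof -
    have "measure \<nu> {k..c} = (LINT x|\<nu>. indicator {k..c} x)" by simp
    also have "\<dots> = (LINT x|\<mu>. w x *\<^sub>R indicator {k..c} x)"
      unfolding \<nu>_def by (subst integral_density) (auto simp: w_nonneg)
    finally show ?thesis by simp
  qed
  with window have "\<forall>\<^sub>F k in at_top. 1 \<le>
      (LINT x|\<mu>. indicator {0..} x * (x ^ n * exp ((p + 1) * x)) * indicator {k..b * k} x)"
    if "1 < b" for b
    using that by (simp add: w_def)
  from implied_vol_limit[OF p window_imp_call_price[OF \<mu> p exp_int this]]
  have "((\<lambda>k. (implied_vol \<mu> k)\<^sup>2 / k) \<longlongrightarrow> psi p) at_top"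
    by (simp add: implied_vol_def)
  then show ?thesis
    by (rule tendsto_imp_asymp_equiv_const) (use psi_bounds[OF p] in simp)
qed

text \<open>The dual law, of the negated log-return under the share measure, exchanges the two wings.\<close>
definition dual_law :: "real measure \<Rightarrow> real measure" where
  "dual_law \<mu> = distr (density \<mu> (\<lambda>x. ennreal (exp x))) borel uminus"

section \<open>Change of measure and reflection of the strike\<close>

lemma dual_law_real_distribution:
  assumes "real_distribution \<mu>" and "(\<integral>\<^sup>+ x. ennreal (exp x) \<partial>\<mu>) = 1"
  shows "real_distribution (dual_law \<mu>)"
proof -
  interpret real_distribution \<mu> by fact
  have "prob_space (density \<mu> (\<lambda>x. ennreal (exp x)))"
    by (rule prob_spaceI) (use assms(2) in \<open>simp add: emeasure_density cong: nn_integral_cong\<close>)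
  then show ?thesis
    unfolding dual_law_def by (rule prob_space.real_distribution_distr) simp
qed

lemma dual_law_integral:
  fixes f :: "real \<Rightarrow> real"
  assumes "real_distribution \<mu>" and [measurable]: "f \<in> borel_measurable borel"
  shows "integrable (dual_law \<mu>) f \<longleftrightarrow> integrable \<mu> (\<lambda>x. exp x * f (- x))"
    and "integral\<^sup>L (dual_law \<mu>) f = (LINT x|\<mu>. exp x * f (- x))"
proof -
  interpret real_distribution \<mu> by fact
  show "integrable (dual_law \<mu>) f \<longleftrightarrow> integrable \<mu> (\<lambda>x. exp x * f (- x))"
    unfolding dual_law_def by (subst integrable_distr_eq) (auto simp: integrable_density)
  show "integral\<^sup>L (dual_law \<mu>) f = (LINT x|\<mu>. exp x * f (- x))"
    unfolding dual_law_def by (subst integral_distr) (auto simp: integral_density)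
qed

text \<open>Market prices satisfy the relation of \<open>bs_call_minus\<close>, by put-call parity
  under the original law. The equations for the volatility are therefore equivalent, and the two
  definite descriptions agree for every \<open>k\<close>, whether or not a solution exists.\<close>

lemma implied_vol_minus:
  assumes \<mu>: "real_distribution \<mu>" and E: "(\<integral>\<^sup>+ x. ennreal (exp x) \<partial>\<mu>) = 1"
  shows "implied_vol \<mu> (- k) = implied_vol (dual_law \<mu>) k"
proof -
  interpret real_distribution \<mu> by fact
  have e: "has_bochner_integral \<mu> exp (1::real)"
    by (rule has_bochner_integral_nn_integral) (use E in auto)
  have ind: "integrable \<mu> (\<lambda>x. (exp x - exp (- k)) * indicator A x)" if "A \<in> sets borel" for A
    using integrable_mult_indicator[of A \<mu> "\<lambda>x. exp x - exp (- k)"] e that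
    by (simp add: mult.commute has_bochner_integral_iff)
  have "exp (- k) * call_price (dual_law \<mu>) k
      = (LINT x|\<mu>. - ((exp x - exp (- k)) * indicator {..- k} x))"
  proof -
    have "call_price (dual_law \<mu>) k = (LINT x|\<mu>. exp x * (indicator {k..} (- x) * (exp (- x) - exp k)))"
      unfolding call_price_def set_lebesgue_integral_def real_scaleR_def
      by (rule dual_law_integral(2)[OF \<mu>]) simp
    then have "exp (- k) * call_price (dual_law \<mu>) k
        = (LINT x|\<mu>. exp (- k) * (exp x * (indicator {k..} (- x) * (exp (- x) - exp k))))" by simp
    also have "\<dots> = (LINT x|\<mu>. - ((exp x - exp (- k)) * indicator {..- k} x))"
      by (intro Bochner_Integration.integral_cong)
         (auto simp: indicator_def algebra_simps simp flip: exp_add)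
    finally show ?thesis .
  qed
  moreover have "call_price \<mu> (- k) = (LINT x|\<mu>. (exp x - exp (- k)) * indicator {- k..} x)"
    unfolding call_price_def set_lebesgue_integral_def by (simp add: mult.commute)
  ultimately have "call_price \<mu> (- k) - exp (- k) * call_price (dual_law \<mu>) k
      = (LINT x|\<mu>. (exp x - exp (- k)) * indicator {- k..} x
          - - ((exp x - exp (- k)) * indicator {..- k} x))"
    using ind by (subst Bochner_Integration.integral_diff) auto
  \<comment> \<open>The half-lines overlap at \<open>- k\<close>, where the integrand
    vanishes.\<close>
  also have "\<dots> = (LINT x|\<mu>. exp x - exp (- k))"
    by (intro Bochner_Integration.integral_cong) (auto simp: indicator_def)
  also have "\<dots> = 1 - exp (- k)"
    using e prob_space by (simp add: has_bochner_integral_iff)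
  finally have "call_price \<mu> (- k) = 1 - exp (- k) + exp (- k) * call_price (dual_law \<mu>) k"
    by simp
  then show ?thesis
    by (simp add: implied_vol_def bs_call_minus)
qed

section \<open>Both wings from \<open>right_wing\<close>\<close>

theorem theorem10:
  fixes \<mu> :: "real measure"
  assumes "real_distribution \<mu>"
    and "(\<integral>\<^sup>+ x. ennreal (exp x) \<partial>\<mu>) = 1"
  shows
    "(\<forall>q::real. q_star \<mu> = ereal q \<and> 0 < q \<and>
        (\<exists>\<rho>>0. \<exists>l\<in>slowly_varying.
           (\<exists>n::nat. (\<lambda>s. (-1) ^ n * (deriv ^^ n) (real_mgf \<mu>) (- q + s))
                       \<sim>[at_right 0] (\<lambda>s. s powr (- \<rho>) * l (1 / s))) \<or>
           (\<lambda>s. ln (real_mgf \<mu> (- q + s))) \<sim>[at_right 0] (\<lambda>s. s powr (- \<rho>) * l (1 / s)))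
        \<longrightarrow> (\<lambda>k. (implied_vol \<mu> (- k))\<^sup>2 / k) \<sim>[at_top] (\<lambda>k. psi q))
     \<and>
     (\<forall>p::real. r_star \<mu> = ereal (p + 1) \<and> 1 < p + 1 \<and>
        (\<exists>\<rho>>0. \<exists>l\<in>slowly_varying.
           (\<exists>n::nat. (\<lambda>s. (deriv ^^ n) (real_mgf \<mu>) (p + 1 - s))
                       \<sim>[at_right 0] (\<lambda>s. s powr (- \<rho>) * l (1 / s))) \<or>
           (\<lambda>s. ln (real_mgf \<mu> (p + 1 - s))) \<sim>[at_right 0] (\<lambda>s. s powr (- \<rho>) * l (1 / s)))
        \<longrightarrow> (\<lambda>k. (implied_vol \<mu> k)\<^sup>2 / k) \<sim>[at_top] (\<lambda>k. psi p))"
proof -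
  interpret real_distribution \<mu> by (rule assms(1))
  have sets: "sets \<mu> = sets borel" by simp
  note int_iff = integrable_exp_iff_mgf[OF sets]
  have int0: "integrable \<mu> (\<lambda>x. exp (0 * x))" by simp
  have int1: "integrable \<mu> (\<lambda>x. exp (1 * x))"
    unfolding int_iff mgf_def using assms(2) by simp
  show ?thesis
  proof (intro conjI allI impI; elim conjE exE bexE)
    fix q \<rho> l
    assume q: "q_star \<mu> = ereal q" "0 < q" and \<rho>: "0 < \<rho>" and l: "l \<in> slowly_varying"
      and as: "(\<exists>n::nat. (\<lambda>s. (-1) ^ n * (deriv ^^ n) (real_mgf \<mu>) (- q + s))
                       \<sim>[at_right 0] (\<lambda>s. s powr (- \<rho>) * l (1 / s))) \<or>
           (\<lambda>s. ln (real_mgf \<mu> (- q + s))) \<sim>[at_right 0] (\<lambda>s. s powr (- \<rho>) * l (1 / s))"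
    \<comment> \<open>The infimum may fail to be attained, but finite moments exist below every
      \<open>t\<close> above \<open>- q\<close>.\<close>
    have left: "\<exists>u<t. integrable \<mu> (\<lambda>x. exp (u * x))" if "- q < t" for t
    proof -
      have "(INF s \<in> {s. mgf \<mu> s < \<infinity>}. ereal s) = ereal (- q)"
        using q(1) unfolding q_star_def by (metis ereal_uminus_uminus uminus_ereal.simps(1))
      also have "\<dots> < ereal t" using that by simp
      finally show ?thesis by (auto simp: INF_less_iff int_iff)
    qed
    \<comment> \<open>The density \<open>exp x\<close> shifts the exponent by one and the reflection
      reverses it, so the critical exponent \<open>- q\<close> becomes \<open>q + 1\<close>; the
      sign \<open>(-1) ^ n\<close> turns \<open>x\<close> into \<open>- x\<close> inside the power.
      The bound \<open>s < q\<close> keeps the exponent below 0, where a moment is finite.\<close>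
    have moment: "(-1) ^ n * (deriv ^^ n) (real_mgf \<mu>) (- q + s)
        = (LINT x|dual_law \<mu>. x ^ n * exp ((q + 1 - s) * x))" if s: "0 < s" "s < q" for n s
    proof -
      obtain u where u: "u < - q + s" "integrable \<mu> (\<lambda>x. exp (u * x))"
        using left[of "- q + s"] s by auto
      have "(deriv ^^ n) (real_mgf \<mu>) (- q + s) = (LINT x|\<mu>. x ^ n * exp ((- q + s) * x))"
        by (rule higher_deriv_real_mgf[OF sets u(2) int0]) (use u s in auto)
      then have "(-1) ^ n * (deriv ^^ n) (real_mgf \<mu>) (- q + s)
          = (LINT x|\<mu>. (-1) ^ n * (x ^ n * exp ((- q + s) * x)))" by simp
      also have "\<dots> = (LINT x|\<mu>. exp x * ((- x) ^ n * exp ((q + 1 - s) * - x)))"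
      proof (intro Bochner_Integration.integral_cong refl)
        fix x :: real
        have "exp x * exp ((q + 1 - s) * - x) = exp ((- q + s) * x)"
          by (simp add: algebra_simps flip: exp_add)
        then show "(-1) ^ n * (x ^ n * exp ((- q + s) * x))
            = exp x * ((- x) ^ n * exp ((q + 1 - s) * - x))"
          by (simp add: power_minus[of x] mult.left_commute[of "exp x"])
      qed
      also have "\<dots> = (LINT x|dual_law \<mu>. x ^ n * exp ((q + 1 - s) * x))"
        by (rule dual_law_integral(2)[OF assms(1), symmetric]) simp
      finally show ?thesis .
    qed
    have ev: "\<forall>\<^sub>F s in at_right 0. s \<in> {0<..<q}"
      by (rule eventually_at_right_real[OF q(2)])
    have "(\<lambda>k. (implied_vol (dual_law \<mu>) k)\<^sup>2 / k) \<sim>[at_top] (\<lambda>k. psi q)"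
    proof (rule right_wing[OF dual_law_real_distribution[OF assms] q(2) _ \<rho> l])
      fix t assume t: "0 \<le> t" "t < q + 1"
      obtain u where u: "u < 1 - t" "integrable \<mu> (\<lambda>x. exp (u * x))"
        using left[of "1 - t"] t by auto
      \<comment> \<open>Interpolation between \<open>u\<close> and 1 leaves out the end point 1,
        which is the case \<open>t = 0\<close>.\<close>
      have "integrable \<mu> (\<lambda>x. exp ((1 - t) * x))"
        using integrable_power_exp[OF sets u(2) int1 u(1), of 0] t int1 by (cases "t = 0") auto
      then show "integrable (dual_law \<mu>) (\<lambda>x. exp (t * x))"
        by (subst dual_law_integral(1)[OF assms(1)]) (auto simp: algebra_simps simp flip: exp_add)
    next
      have m: "\<forall>\<^sub>F s in at_right 0. (-1) ^ n * (deriv ^^ n) (real_mgf \<mu>) (- q + s)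
          = (LINT x|dual_law \<mu>. x ^ n * exp ((q + 1 - s) * x))" for n
        using ev by eventually_elim (rule moment; simp)
      have 1: "(\<lambda>s. (-1) ^ n * (deriv ^^ n) (real_mgf \<mu>) (- q + s)) \<sim>[at_right 0] g \<longleftrightarrow>
          (\<lambda>s. LINT x|dual_law \<mu>. x ^ n * exp ((q + 1 - s) * x)) \<sim>[at_right 0] g" for n g
        by (rule asymp_equiv_cong[OF m]) simp
      have 2: "(\<lambda>s. ln (real_mgf \<mu> (- q + s))) \<sim>[at_right 0] g \<longleftrightarrow>
          (\<lambda>s. ln (LINT x|dual_law \<mu>. exp ((q + 1 - s) * x))) \<sim>[at_right 0] g" for g
        by (rule asymp_equiv_cong) (use m[of 0] in \<open>auto elim!: eventually_mono\<close>)
      show "(\<exists>n. (\<lambda>s. LINT x|dual_law \<mu>. x ^ n * exp ((q + 1 - s) * x))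
          \<sim>[at_right 0] (\<lambda>s. s powr - \<rho> * l (1 / s))) \<or>
        (\<lambda>s. ln (LINT x|dual_law \<mu>. exp ((q + 1 - s) * x)))
          \<sim>[at_right 0] (\<lambda>s. s powr - \<rho> * l (1 / s))"
        using as unfolding 1 2 .
    qed
    then show "(\<lambda>k. (implied_vol \<mu> (- k))\<^sup>2 / k) \<sim>[at_top] (\<lambda>k. psi q)"
      by (simp add: implied_vol_minus[OF assms])
  next
    fix p \<rho> l
    assume p: "r_star \<mu> = ereal (p + 1)" "1 < p + 1" and \<rho>: "0 < \<rho>" and l: "l \<in> slowly_varying"
      and as: "(\<exists>n::nat. (\<lambda>s. (deriv ^^ n) (real_mgf \<mu>) (p + 1 - s))
                       \<sim>[at_right 0] (\<lambda>s. s powr (- \<rho>) * l (1 / s))) \<or>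
           (\<lambda>s. ln (real_mgf \<mu> (p + 1 - s))) \<sim>[at_right 0] (\<lambda>s. s powr (- \<rho>) * l (1 / s))"
    have right: "\<exists>u>t. integrable \<mu> (\<lambda>x. exp (u * x))" if "t < p + 1" for t
    proof -
      have "ereal t < (SUP s \<in> {s. mgf \<mu> s < \<infinity>}. ereal s)"
        using p(1) that unfolding r_star_def by simp
      then show ?thesis by (auto simp: less_SUP_iff int_iff)
    qed
    have moment: "(deriv ^^ n) (real_mgf \<mu>) (p + 1 - s)
        = (LINT x|\<mu>. x ^ n * exp ((p + 1 - s) * x))" if s: "0 < s" "s < p + 1" for n s
    proof -
      obtain u where u: "p + 1 - s < u" "integrable \<mu> (\<lambda>x. exp (u * x))"
        using right[of "p + 1 - s"] s by auto
      show ?thesis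
        by (rule higher_deriv_real_mgf[OF sets int0 u(2)]) (use u s in auto)
    qed
    have ev: "\<forall>\<^sub>F s in at_right 0. s \<in> {0<..<p + 1}"
      by (rule eventually_at_right_real) (use p in simp)
    show "(\<lambda>k. (implied_vol \<mu> k)\<^sup>2 / k) \<sim>[at_top] (\<lambda>k. psi p)"
    proof (rule right_wing[OF assms(1) _ _ \<rho> l])
      show "0 < p" using p by simp
      fix t assume t: "0 \<le> t" "t < p + 1"
      obtain u where u: "t < u" "integrable \<mu> (\<lambda>x. exp (u * x))"
        using right[of t] t by auto
      show "integrable \<mu> (\<lambda>x. exp (t * x))"
        using integrable_power_exp[OF sets int0 u(2) _ u(1), of 0] t by (cases "t = 0") auto
    next
      have m: "\<forall>\<^sub>F s in at_right 0. (deriv ^^ n) (real_mgf \<mu>) (p + 1 - s)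
          = (LINT x|\<mu>. x ^ n * exp ((p + 1 - s) * x))" for n
        using ev by eventually_elim (rule moment; simp)
      have 1: "(\<lambda>s. (deriv ^^ n) (real_mgf \<mu>) (p + 1 - s)) \<sim>[at_right 0] g \<longleftrightarrow>
          (\<lambda>s. LINT x|\<mu>. x ^ n * exp ((p + 1 - s) * x)) \<sim>[at_right 0] g" for n g
        by (rule asymp_equiv_cong[OF m]) simp
      have 2: "(\<lambda>s. ln (real_mgf \<mu> (p + 1 - s))) \<sim>[at_right 0] g \<longleftrightarrow>
          (\<lambda>s. ln (LINT x|\<mu>. exp ((p + 1 - s) * x))) \<sim>[at_right 0] g" for g
        by (simp add: real_mgf_eq_integral[OF sets])
      show "(\<exists>n. (\<lambda>s. LINT x|\<mu>. x ^ n * exp ((p + 1 - s) * x))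
          \<sim>[at_right 0] (\<lambda>s. s powr - \<rho> * l (1 / s))) \<or>
        (\<lambda>s. ln (LINT x|\<mu>. exp ((p + 1 - s) * x)))
          \<sim>[at_right 0] (\<lambda>s. s powr - \<rho> * l (1 / s))"
        using as unfolding 1 2 .
    qed
  qed
qed

end
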